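(* There exists an arrangement of four smooth conics in $\mathbb P^2_{\mathbb C}$ whose singular points are exactly $n_2=3$ nodes, $t_3=9$ tacnodes, and $n_3=1$ ordinary triple point; that is, the weak combinatorics $(n_2,t_3,n_3)=(3,9,1)$ is geometrically realizable over $\mathbb C$ by an arrangement of four smooth conics.
   Context: An arrangement of four smooth conics is the union of four distinct smooth conics in $\mathbb P^2_{\mathbb C}$. A node is an $A_1$ singularity (two smooth branches meeting transversally), a tacnode is an $A_3$ singularity (two smooth branches with intersection multiplicity $2$), and an ordinary triple point is a point at which three smooth branches meet pairwise transversally. *)

theory Defs
  imports "HOL-Analysis.Analysis" "HOL-Computational_Algebra.Formal_Power_Series"
begin

section \<open>Plane projective conics\<close>

text \<open>A point of the complex projective plane is a one-dimensional subspace of \<open>\<complex>\<^sup>3\<close>.\<close>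

definition proj_plane :: "(complex^3) set set" where
  "proj_plane = {vec.span {p} | p. p \<noteq> 0}"

text \<open>
  The matrix need not be symmetric: different matrices may give the same form, so conics are
  compared through their point sets and not through their matrices.
\<close>

definition qform :: "complex^3^3 \<Rightarrow> complex^3 \<Rightarrow> complex" where
  "qform A x = (\<Sum>i\<in>UNIV. \<Sum>j\<in>UNIV. A $ i $ j * x $ i * x $ j)"

definition curve :: "(complex^3 \<Rightarrow> complex) \<Rightarrow> (complex^3) set set" where
  "curve F = {P \<in> proj_plane. \<forall>p\<in>P. F p = 0}"

text \<open>
  \<open>F\<close> is meant to be a homogeneous polynomial, given as a function on \<open>\<complex>\<^sup>3\<close>. As a polynomial map
  is holomorphic, its real derivative vanishes iff all its complex partial derivatives do.
\<close>

definition sing_points :: "(complex^3 \<Rightarrow> complex) \<Rightarrow> (complex^3) set set" where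
  "sing_points F = {P \<in> curve F. \<forall>p\<in>P - {0}. (F has_derivative (\<lambda>_. 0)) (at p)}"

definition smooth_conic :: "complex^3^3 \<Rightarrow> bool" where
  "smooth_conic A \<longleftrightarrow> sing_points (qform A) = {}"

text \<open>
  The (projective) tangent line at \<open>P\<close>, as a plane in \<open>\<complex>\<^sup>3\<close>. The representative \<open>p = 0\<close> imposes no
  condition, and all the others impose the same one.
\<close>

definition tangent_line :: "complex^3^3 \<Rightarrow> (complex^3) set \<Rightarrow> (complex^3) set" where
  "tangent_line A P = {v. \<forall>p\<in>P. frechet_derivative (qform A) (at p) v = 0}"

definition transversal_at :: "complex^3^3 \<Rightarrow> complex^3^3 \<Rightarrow> (complex^3) set \<Rightarrow> bool" where
  "transversal_at A B P \<longleftrightarrow> tangent_line A P \<noteq> tangent_line B P"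


section \<open>Intersection multiplicity\<close>

text \<open>
  The ring \<open>\<complex>[[X,Y]]\<close> is rendered as \<open>complex fps fps\<close>, where the inner variable is \<open>X\<close> and
  the outer variable is \<open>Y\<close>.
\<close>

type_synonym series2 = "complex fps fps"

definition const2 :: "complex \<Rightarrow> series2" where
  "const2 c = fps_const (fps_const c)"

definition X2 :: series2 where "X2 = fps_const fps_X"

definition Y2 :: series2 where "Y2 = fps_X"

text \<open>
  If \<open>p, u, v\<close> is a basis of \<open>\<complex>\<^sup>3\<close>, then \<open>(X, Y) \<mapsto> [p + X u + Y v]\<close> is an affine chart of the
  projective plane with origin \<open>[p]\<close>; \<open>local_eq A p u v\<close> is the equation of the conic in it.
\<close>

definition local_eq :: "complex^3^3 \<Rightarrow> complex^3 \<Rightarrow> complex^3 \<Rightarrow> complex^3 \<Rightarrow> series2" where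
  "local_eq A p u v =
     (let z = (\<lambda>i. const2 (p $ i) + X2 * const2 (u $ i) + Y2 * const2 (v $ i))
      in \<Sum>i\<in>UNIV. \<Sum>j\<in>UNIV. const2 (A $ i $ j) * z i * z j)"

definition ideal2 :: "series2 \<Rightarrow> series2 \<Rightarrow> series2 set" where
  "ideal2 f g = {a * f + b * g | a b. True}"

text \<open>
  The quotient by \<open>I\<close> has complex dimension \<open>n\<close>: the classes of some \<open>e 0, \<dots>, e (n - 1)\<close> form a
  basis of it.
\<close>

definition quotient_dim :: "series2 set \<Rightarrow> nat \<Rightarrow> bool" where
  "quotient_dim I n \<longleftrightarrow>
     (\<exists>e :: nat \<Rightarrow> series2. \<forall>h. \<exists>!c :: nat \<Rightarrow> complex.
        (\<forall>i\<ge>n. c i = 0) \<and> h - (\<Sum>i<n. const2 (c i) * e i) \<in> I)"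

text \<open>
  The local intersection multiplicity at \<open>P\<close> is \<open>dim \<complex>[[X,Y]]/(f,g)\<close> for local equations \<open>f\<close>, \<open>g\<close>;
  it does not depend on the chart.
\<close>

definition intersection_mult :: "complex^3^3 \<Rightarrow> complex^3^3 \<Rightarrow> (complex^3) set \<Rightarrow> nat \<Rightarrow> bool" where
  "intersection_mult A B P n \<longleftrightarrow>
     (\<forall>p\<in>P. \<forall>u v. det (vector [p, u, v] :: complex^3^3) \<noteq> 0 \<longrightarrow>
        quotient_dim (ideal2 (local_eq A p u v) (local_eq B p u v)) n)"


section \<open>Arrangements of smooth conics\<close>

definition conic_arrangement :: "(complex^3^3) set \<Rightarrow> bool" where
  "conic_arrangement \<A> \<longleftrightarrow>
     finite \<A> \<and> (\<forall>A\<in>\<A>. smooth_conic A) \<and> inj_on (\<lambda>A. curve (qform A)) \<A>"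

definition arr_sing :: "(complex^3^3) set \<Rightarrow> (complex^3) set set" where
  "arr_sing \<A> = sing_points (\<lambda>x. \<Prod>A\<in>\<A>. qform A x)"

definition branches :: "(complex^3^3) set \<Rightarrow> (complex^3) set \<Rightarrow> (complex^3^3) set" where
  "branches \<A> P = {A \<in> \<A>. P \<in> curve (qform A)}"

text \<open>As the members are smooth, each member through \<open>P\<close> has exactly one, smooth, branch at \<open>P\<close>.\<close>

definition nodes :: "(complex^3^3) set \<Rightarrow> (complex^3) set set" where
  "nodes \<A> = {P \<in> arr_sing \<A>. \<exists>A B. A \<noteq> B \<and> branches \<A> P = {A, B} \<and> transversal_at A B P}"

definition tacnodes :: "(complex^3^3) set \<Rightarrow> (complex^3) set set" where
  "tacnodes \<A> = {P \<in> arr_sing \<A>. \<exists>A B. A \<noteq> B \<and> branches \<A> P = {A, B} \<and> intersection_mult A B P 2}"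

definition ordinary_triple_points :: "(complex^3^3) set \<Rightarrow> (complex^3) set set" where
  "ordinary_triple_points \<A> =
     {P \<in> arr_sing \<A>. card (branches \<A> P) = 3 \<and>
        pairwise (\<lambda>A B. transversal_at A B P) (branches \<A> P)}"

end

theory Submission
  imports Defs
begin

text \<open>
  Let \<open>Q = z\<^sup>2 - 4xy\<close>. The conics bitangent to \<open>Q = 0\<close> have the form \<open>Q = L\<^sup>2\<close>; those through
  \<open>[0 : 0 : 1]\<close> can be written \<open>m\<^sup>2 + zm + xy = 0\<close> with \<open>L = z + 2m\<close> and \<open>m = v\<^sup>2x + u\<^sup>2y\<close>. Two of
  them, given by \<open>(u, v)\<close> and \<open>(u', v')\<close>, meet on the lines \<open>m = m'\<close> and \<open>z + m + m' = 0\<close>. The first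
  one passes through \<open>[0 : 0 : 1]\<close> and one more point, a node; the second one is tangent to both
  conics at a common point as soon as \<open>(uv' - vu')\<^sup>2 = 1\<close>. The three vectors \<open>(1, 1)\<close>, \<open>(1, 2)\<close> and
  \<open>(2, 3) = (1, 1) + (1, 2)\<close> satisfy this condition pairwise. With the conic \<open>Q = 0\<close> they give one
  triple point, three nodes, three tacnodes among the bitangent conics and six tacnodes on \<open>Q = 0\<close>.

  A tacnode is recognized from equations \<open>f = m a + \<alpha> s\<^sup>2\<close> and \<open>g = m b + \<beta> s\<^sup>2\<close> with \<open>m\<close> and
  \<open>s\<close> independent linear forms at the point: if \<open>a \<beta> - b \<alpha>\<close> is a unit, then \<open>(f, g) = (m, s\<^sup>2)\<close>.
\<close>

section \<open>Ideals of bivariate power series\<close>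

unbundle no vec_syntax
unbundle fps_syntax

lemma const2_add: "const2 (a + b) = const2 a + const2 b"
  and const2_diff: "const2 (a - b) = const2 a - const2 b"
  and const2_mult: "const2 (a * b) = const2 a * const2 b"
  and const2_0 [simp]: "const2 0 = 0"
  and const2_1 [simp]: "const2 1 = 1"
  by (simp_all add: const2_def)

lemma const2_nth [simp]: "const2 c $ 0 $ 0 = c" "const2 c $ 0 $ Suc n = 0" "const2 c $ Suc n = 0"
  by (simp_all add: const2_def)

lemma X2_nth [simp]: "X2 $ 0 = fps_X" "X2 $ Suc n = 0"
  and Y2_nth [simp]: "Y2 $ 0 = 0" "Y2 $ Suc 0 = 1"
  by (simp_all add: X2_def Y2_def)

text \<open>The ring is local: a nonzero constant term makes the coefficient of \<open>Y^0\<close> a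
  unit of the inner ring, and that makes the series a unit of the outer one.\<close>

lemma series2_is_unit:
  fixes D :: series2
  assumes "D $ 0 $ 0 \<noteq> 0"
  obtains D' where "D' * D = 1"
proof -
  have "D $ 0 * inverse (D $ 0) = 1"
    using assms by (rule inverse_mult_eq_1')
  then have "D * fps_right_inverse D (inverse (D $ 0)) = 1"
    by (rule fps_right_inverse)
  then show thesis
    by (intro that) (simp add: mult.commute)
qed

text \<open>The part free of \<open>Y\<close> has no constant term, hence is divisible by
  \<open>X\<close>; the rest is divisible by \<open>Y\<close>.\<close>

lemma series2_maximal_ideal:
  fixes h :: series2
  assumes "h $ 0 $ 0 = 0"
  obtains h1 h2 where "h = X2 * h1 + Y2 * h2"
proof
  have "h $ 0 = fps_X * fps_shift 1 (h $ 0)"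
    using assms by (intro fps_ext) (auto simp: fps_X_mult_nth)
  moreover have "h = fps_const (h $ 0) + fps_X * fps_shift 1 h"
    by (intro fps_ext) (auto simp: fps_X_mult_nth)
  ultimately show "h = X2 * fps_const (fps_shift 1 (h $ 0)) + Y2 * fps_shift 1 h"
    by (simp add: X2_def Y2_def)
qed

section \<open>Ideals with two generators\<close>

lemma ideal2_commute: "ideal2 f g = ideal2 g f"
  unfolding ideal2_def by (metis add.commute)

lemma ideal2_mult_left: "h \<in> ideal2 f g \<Longrightarrow> k * h \<in> ideal2 f g"
  unfolding ideal2_def by (clarsimp simp: distrib_left mult.assoc[symmetric]) blast

lemma ideal2_add: "h \<in> ideal2 f g \<Longrightarrow> k \<in> ideal2 f g \<Longrightarrow> h + k \<in> ideal2 f g"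
  unfolding ideal2_def
proof clarify
  fix a b a' b'
  have "a * f + b * g + (a' * f + b' * g) = (a + a') * f + (b + b') * g"
    by (simp add: algebra_simps)
  then show "\<exists>c d. a * f + b * g + (a' * f + b' * g) = c * f + d * g \<and> True" by blast
qed

lemma ideal2_gen: "f \<in> ideal2 f g" "g \<in> ideal2 f g"
  unfolding ideal2_def
  by (rule CollectI, rule exI[of _ 1], rule exI[of _ 0], simp)
     (rule CollectI, rule exI[of _ 0], rule exI[of _ 1], simp)

lemma ideal2_unit_mult:
  assumes "D $ 0 $ 0 \<noteq> 0" "D * h \<in> ideal2 f g"
  shows "h \<in> ideal2 f g"
proof -
  obtain D' where "D' * D = 1"
    using series2_is_unit[OF assms(1)] .
  then have "D' * (D * h) = h"
    by (metis mult.assoc mult_1)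
  then show ?thesis
    using ideal2_mult_left[OF assms(2), of D'] by metis
qed

section \<open>Linear forms as local parameters\<close>

definition lin2 :: "complex \<Rightarrow> complex \<Rightarrow> series2" where
  "lin2 a b = X2 * const2 a + Y2 * const2 b"

text \<open>Coefficients of degree at most one are enough to decide membership in an ideal
  \<open>(m, s^2)\<close> with \<open>m\<close> and \<open>s\<close> independent linear
  forms.\<close>

lemma lin2_mult_nth:
  "(lin2 a b * h) $ 0 $ 0 = 0"
  "(lin2 a b * h) $ 0 $ Suc 0 = a * h $ 0 $ 0"
  "(lin2 a b * h) $ Suc 0 $ 0 = b * h $ 0 $ 0"
  by (simp_all add: lin2_def X2_def Y2_def const2_def fps_mult_nth algebra_simps)

lemma lin2_nth [simp]:
  "lin2 a b $ 0 $ 0 = 0" "lin2 a b $ 0 $ Suc 0 = a" "lin2 a b $ Suc 0 $ 0 = b"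
  using lin2_mult_nth[of a b 1] by simp_all

text \<open>Cramer's rule: a nonzero determinant makes \<open>X\<close> and \<open>Y\<close>
  combinations of the two linear forms.\<close>

lemma lin2_maximal_ideal:
  fixes h :: series2
  assumes "a * d - b * c \<noteq> 0" "h $ 0 $ 0 = 0"
  obtains h1 h2 where "h = lin2 a b * h1 + lin2 c d * h2"
proof -
  define \<Delta> where "\<Delta> = a * d - b * c"
  have 1: "const2 (inverse \<Delta>) * const2 \<Delta> = 1"
    using assms by (simp flip: const2_mult add: \<Delta>_def)
  have D: "const2 \<Delta> = const2 a * const2 d - const2 b * const2 c"
    by (simp add: \<Delta>_def const2_mult const2_diff)
  obtain k1 k2 where h: "h = X2 * k1 + Y2 * k2"
    using series2_maximal_ideal[OF assms(2)] .
  let ?i = "const2 (inverse \<Delta>)"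
  have "h = ?i * const2 \<Delta> * (X2 * k1 + Y2 * k2)"
    by (simp add: h 1)
  also have "\<dots> = lin2 a b * (?i * (const2 d * k1 - const2 c * k2))
      + lin2 c d * (?i * (const2 a * k2 - const2 b * k1))"
    unfolding D lin2_def by (simp add: algebra_simps)
  finally show thesis by (rule that)
qed

text \<open>Once the ideal is known to be \<open>(m, s^2)\<close>, membership is tested on two
  numbers: the constant term and the derivative along the line \<open>m = 0\<close>. Hence
  \<open>1\<close> and \<open>s\<close> represent a basis of the quotient.\<close>

lemma quotient_dim_2I:
  fixes f g m a b s :: series2
  assumes m: "m = lin2 m1 m2" and s: "s = lin2 s1 s2"
    and indep: "m1 * s2 - m2 * s1 \<noteq> 0"
    and f: "f = m * a + const2 \<alpha> * s\<^sup>2" and g: "g = m * b + const2 \<beta> * s\<^sup>2"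
    and unit: "a $ 0 $ 0 * \<beta> - b $ 0 $ 0 * \<alpha> \<noteq> 0"
  shows "quotient_dim (ideal2 f g) 2"
proof -
  let ?I = "ideal2 f g"
  let ?D = "const2 \<beta> * a - const2 \<alpha> * b"
  \<comment> \<open>\<open>\<phi>\<close> is the derivative at the origin in the direction
    \<open>(m2, - m1)\<close>, along which \<open>m\<close> vanishes; the first index counts powers
    of \<open>Y\<close>, the second powers of \<open>X\<close>.\<close>
  define \<phi> where "\<phi> h = h $ 0 $ Suc 0 * m2 - h $ Suc 0 $ 0 * m1" for h :: series2
  have \<phi>_add: "\<phi> (h + k) = \<phi> h + \<phi> k" and \<phi>_diff: "\<phi> (h - k) = \<phi> h - \<phi> k" for h k
    by (simp_all add: \<phi>_def algebra_simps)
  have \<phi>m: "\<phi> (m * h) = 0" and \<phi>s: "\<phi> (s * h) = \<phi> s * h $ 0 $ 0" for h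
    by (simp_all add: \<phi>_def m s lin2_mult_nth algebra_simps)
  have \<phi>s0: "\<phi> s \<noteq> 0"
    using indep by (simp add: \<phi>_def s algebra_simps)
  \<comment> \<open>Eliminating \<open>s^2\<close> from the two equations leaves a unit multiple of
    \<open>m\<close>.\<close>
  have "?D * m = const2 \<beta> * f + (- const2 \<alpha>) * g"
    by (simp add: f g algebra_simps)
  then have "?D * m \<in> ?I"
    by (metis ideal2_add ideal2_mult_left ideal2_gen)
  moreover have "?D $ 0 $ 0 \<noteq> 0"
    using unit by (simp add: algebra_simps)
  ultimately have mI: "m \<in> ?I" by (rule ideal2_unit_mult[rotated])
  have sI: "s\<^sup>2 \<in> ?I"
  proof -
    have "const2 \<alpha> * s\<^sup>2 = f + (- a) * m" "const2 \<beta> * s\<^sup>2 = g + (- b) * m"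
      by (simp_all add: f g)
    then have "const2 \<alpha> * s\<^sup>2 \<in> ?I" "const2 \<beta> * s\<^sup>2 \<in> ?I"
      by (metis mI ideal2_add ideal2_mult_left ideal2_gen)+
    moreover have "\<alpha> \<noteq> 0 \<or> \<beta> \<noteq> 0" using unit by auto
    ultimately show ?thesis
      using ideal2_unit_mult[of "const2 \<alpha>"] ideal2_unit_mult[of "const2 \<beta>"] by auto
  qed
  have mem: "h \<in> ?I \<longleftrightarrow> h $ 0 $ 0 = 0 \<and> \<phi> h = 0" for h
  proof
    assume "h \<in> ?I"
    then obtain x y where "h = x * f + y * g" by (auto simp: ideal2_def)
    then have h: "h = m * (x * a + y * b) + s * (s * (const2 \<alpha> * x + const2 \<beta> * y))"
      by (simp add: f g algebra_simps power2_eq_square)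
    show "h $ 0 $ 0 = 0 \<and> \<phi> h = 0"
      unfolding h \<phi>_add \<phi>m \<phi>s by (simp add: m s lin2_mult_nth)
  next
    assume h0: "h $ 0 $ 0 = 0 \<and> \<phi> h = 0"
    obtain h1 h2 where h: "h = m * h1 + s * h2"
      using lin2_maximal_ideal[OF indep] h0 unfolding m s by blast
    \<comment> \<open>Only \<open>s * h2\<close> contributes to \<open>\<phi> h\<close>, so
      \<open>h2\<close> lies in the maximal ideal and can be expanded once more.\<close>
    have "h2 $ 0 $ 0 = 0"
      using h0 \<phi>s0 unfolding h \<phi>_add \<phi>m \<phi>s by simp
    then obtain h3 h4 where h2: "h2 = m * h3 + s * h4"
      using lin2_maximal_ideal[OF indep] unfolding m s by blast
    have "h = (h1 + s * h3) * m + h4 * s\<^sup>2"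
      by (simp add: h h2 algebra_simps power2_eq_square)
    then show "h \<in> ?I"
      by (metis mI sI ideal2_add ideal2_mult_left)
  qed
  define e where "e i = (if i = 0 then 1 else s)" for i :: nat
  have ex1: "\<exists>!c. (\<forall>i\<ge>2. c i = 0) \<and> h - (\<Sum>i<2. const2 (c i) * e i) \<in> ?I" for h
  proof -
    \<comment> \<open>The two tests force the coordinates with respect to \<open>1\<close> and
      \<open>s\<close>; the value 0 from index 2 on is the normalization in
      \<open>quotient_dim\<close>.\<close>
    define c\<^sub>0 where "c\<^sub>0 i = (if i = 0 then h $ 0 $ 0 else if i = 1 then \<phi> h / \<phi> s else 0)" for i :: nat
    have eq: "h - (\<Sum>i<2. const2 (c i) * e i) \<in> ?I
        \<longleftrightarrow> c 0 = h $ 0 $ 0 \<and> c 1 = \<phi> h / \<phi> s" for c :: "nat \<Rightarrow> complex"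
    proof -
      have "\<phi> (const2 (c 0)) = 0" "\<phi> (const2 (c 1) * s) = \<phi> s * c 1"
        using \<phi>s[of "const2 (c 1)"] by (simp_all add: \<phi>_def mult.commute)
      moreover have "(const2 (c 1) * s) $ 0 $ 0 = 0"
        by (simp add: s)
      ultimately show ?thesis
        using \<phi>s0 unfolding mem
        by (auto simp: e_def numeral_2_eq_2 \<phi>_diff \<phi>_add field_simps)
    qed
    show ?thesis
    proof (rule ex1I[of _ c\<^sub>0])
      show "(\<forall>i\<ge>2. c\<^sub>0 i = 0) \<and> h - (\<Sum>i<2. const2 (c\<^sub>0 i) * e i) \<in> ?I"
        unfolding eq by (simp add: c\<^sub>0_def)
    next
      fix c :: "nat \<Rightarrow> complex"
      assume c: "(\<forall>i\<ge>2. c i = 0) \<and> h - (\<Sum>i<2. const2 (c i) * e i) \<in> ?I"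
      show "c = c\<^sub>0"
      proof
        fix i :: nat
        consider "i = 0" | "i = 1" | "i \<ge> 2" by linarith
        then show "c i = c\<^sub>0 i"
          using c unfolding eq by cases (auto simp: c\<^sub>0_def)
      qed
    qed
  qed
  show ?thesis
    unfolding quotient_dim_def
    by (rule exI[of _ e], rule allI, rule ex1)
qed

text \<open>A nonzero Jacobian makes \<open>f\<close> and \<open>g\<close> generate the whole
  maximal ideal. Any two classes in the quotient are then linearly dependent, so \<open>0\<close>
  has more than one coordinate vector.\<close>

lemma quotient_dim_transversal:
  fixes f g :: series2
  assumes f0: "f $ 0 $ 0 = 0" and g0: "g $ 0 $ 0 = 0"
    and jac: "f $ 0 $ Suc 0 * g $ Suc 0 $ 0 - f $ Suc 0 $ 0 * g $ 0 $ Suc 0 \<noteq> 0"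
  shows "\<not> quotient_dim (ideal2 f g) 2"
proof
  let ?I = "ideal2 f g"
  assume "quotient_dim ?I 2"
  then obtain e :: "nat \<Rightarrow> series2" where e: "\<forall>h. \<exists>!c. (\<forall>i\<ge>2. c i = 0) \<and> h - (\<Sum>i<2. const2 (c i) * e i) \<in> ?I"
    unfolding quotient_dim_def by blast
  obtain f1 f2 where f: "f = X2 * f1 + Y2 * f2"
    using series2_maximal_ideal[OF f0] .
  obtain g1 g2 where g: "g = X2 * g1 + Y2 * g2"
    using series2_maximal_ideal[OF g0] .
  have f_nth: "f $ 0 $ Suc 0 = f1 $ 0 $ 0" "f $ Suc 0 $ 0 = f2 $ 0 $ 0"
    unfolding f by (simp_all add: X2_def Y2_def fps_mult_nth)
  have g_nth: "g $ 0 $ Suc 0 = g1 $ 0 $ 0" "g $ Suc 0 $ 0 = g2 $ 0 $ 0"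
    unfolding g by (simp_all add: X2_def Y2_def fps_mult_nth)
  let ?D = "f1 * g2 - f2 * g1"
  have "?D $ 0 $ 0 \<noteq> 0"
    using jac unfolding f_nth g_nth by simp
  moreover have "?D * X2 = g2 * f + (- f2) * g" "?D * Y2 = f1 * g + (- g1) * f"
    by (simp_all add: f g algebra_simps)
  then have "?D * X2 \<in> ?I" "?D * Y2 \<in> ?I"
    by (metis ideal2_add ideal2_mult_left ideal2_gen)+
  ultimately have XY: "X2 \<in> ?I" "Y2 \<in> ?I"
    using ideal2_unit_mult by blast+
  have mem: "h \<in> ?I" if h0: "h $ 0 $ 0 = 0" for h
  proof -
    obtain h1 h2 where "h = X2 * h1 + Y2 * h2"
      using series2_maximal_ideal[OF h0] .
    then have "h = h1 * X2 + h2 * Y2"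
      by (simp add: mult.commute)
    then show ?thesis by (metis XY ideal2_add ideal2_mult_left)
  qed
  define a where "a = e 0 $ 0 $ 0"
  define b where "b = e 1 $ 0 $ 0"
  \<comment> \<open>A nontrivial relation between the constant terms \<open>a\<close> and
    \<open>b\<close>: the pair \<open>(b, - a)\<close>, or \<open>(1, 0)\<close> if both are
    zero.\<close>
  define c where "c i = (if i = 0 then (if a = 0 \<and> b = 0 then 1 else b) else if i = 1 then - a else 0)"
    for i :: nat
  define P where "P c \<longleftrightarrow> (\<forall>i\<ge>2. c i = 0) \<and> 0 - (\<Sum>i<2. const2 (c i) * e i) \<in> ?I" for c
  have "0 - (\<Sum>i<2. const2 (c i) * e i) \<in> ?I"
    by (rule mem) (simp add: numeral_2_eq_2 c_def a_def b_def algebra_simps)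
  then have "P c"
    by (simp add: P_def c_def)
  moreover have "P (\<lambda>_. 0)"
    by (simp add: P_def mem)
  moreover have "\<exists>!c. P c"
    unfolding P_def by (rule e[THEN spec])
  ultimately have "c = (\<lambda>_. 0)"
    by blast
  then have "c 0 = 0" "c 1 = 0" by simp_all
  then show False
    by (auto simp: c_def split: if_splits)
qed

unbundle no fps_syntax
unbundle vec_syntax


section \<open>Quadratic forms and their local equations\<close>

text \<open>The polarization of the form, which is its derivative at \<open>p\<close> in the
  direction \<open>h\<close>. Both index orders occur because the matrix need not be
  symmetric.\<close>

definition polar :: "complex^3^3 \<Rightarrow> complex^3 \<Rightarrow> complex^3 \<Rightarrow> complex" where
  "polar A p h = (\<Sum>i\<in>UNIV. \<Sum>j\<in>UNIV. A $ i $ j * (p $ i * h $ j + h $ i * p $ j))"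

lemma qform_scale: "qform A (k *s x) = k\<^sup>2 * qform A x"
  unfolding qform_def by (simp add: sum_distrib_left power2_eq_square mult_ac)

lemma polar_scale: "polar A (k *s x) h = k * polar A x h"
  unfolding polar_def by (simp add: sum_distrib_left algebra_simps)

lemma qform_add: "qform A (x + y) = qform A x + polar A x y + qform A y"
  unfolding qform_def polar_def by (simp add: sum.distrib[symmetric] algebra_simps)

lemma polar_add_scale: "polar A p (a *s u + b *s v) = a * polar A p u + b * polar A p v"
  unfolding polar_def by (simp add: sum_distrib_left sum.distrib[symmetric] algebra_simps)

lemma qform_has_derivative: "(qform A has_derivative polar A p) (at p)"
proof -
  have nth: "((\<lambda>x :: complex^3. x $ i) has_derivative (\<lambda>h. h $ i)) (at p)" for i
    by (rule bounded_linear.has_derivative[OF bounded_linear_vec_nth has_derivative_ident])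
  show ?thesis
    unfolding qform_def polar_def
    by (rule derivative_eq_intros nth refl)+ (simp add: algebra_simps)
qed

lemma tangent_line_eq: "tangent_line A P = {v. \<forall>p\<in>P. polar A p v = 0}"
  unfolding tangent_line_def
  by (simp add: frechet_derivative_at[OF qform_has_derivative, symmetric])

lemma tangent_line_span: "tangent_line A (vec.span {p}) = {v. polar A p v = 0}"
  unfolding tangent_line_eq vec.span_singleton
  by (auto simp: polar_scale)

lemma proj_planeE:
  assumes "P \<in> proj_plane"
  obtains p where "p \<noteq> 0" "P = vec.span {p}"
  using assms unfolding proj_plane_def by blast

lemma span_in_proj_plane: "p \<noteq> 0 \<Longrightarrow> vec.span {p} \<in> proj_plane"
  unfolding proj_plane_def by blast

lemma span_scale: "k \<noteq> 0 \<Longrightarrow> vec.span {k *s p} = vec.span {p :: complex^3}"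
  unfolding vec.span_singleton
  by (auto simp: image_iff) (metis (no_types) divide_self_if mult.commute mult_1 times_divide_eq_left vector_smult_assoc)

lemma span_in_curve_iff:
  assumes "p \<noteq> 0"
  shows "vec.span {p} \<in> curve (qform A) \<longleftrightarrow> qform A p = 0"
  unfolding curve_def using span_in_proj_plane[OF assms]
  by (auto simp: vec.span_singleton qform_scale)

lemma smooth_conicI:
  assumes "\<And>p. (\<And>h. polar A p h = 0) \<Longrightarrow> p = 0"
  shows "smooth_conic A"
proof -
  have "P \<notin> sing_points (qform A)" for P
  proof
    assume "P \<in> sing_points (qform A)"
    then obtain p where p: "p \<noteq> 0" "P = vec.span {p}"
      and d: "\<forall>q\<in>P - {0}. (qform A has_derivative (\<lambda>_. 0)) (at q)"
      by (auto simp: sing_points_def curve_def elim: proj_planeE)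
    have "p \<in> P - {0}"
      using p by (simp add: vec.span_base)
    then have "polar A p = (\<lambda>_. 0)"
      using d qform_has_derivative has_derivative_unique by blast
    then show False
      using assms[of p] p by simp
  qed
  then show ?thesis by (auto simp: smooth_conic_def)
qed

text \<open>Singularity is a condition on all representatives of a point, but the polar form scales
  with the representative, so a single one decides.\<close>

lemma smooth_conic_polar:
  assumes "smooth_conic A" "p \<noteq> 0" "qform A p = 0"
  shows "polar A p \<noteq> (\<lambda>_. 0)"
proof
  assume 0: "polar A p = (\<lambda>_. 0)"
  have "(qform A has_derivative (\<lambda>_. 0)) (at (k *s p))" for k
  proof -
    have "polar A (k *s p) = (\<lambda>_. 0)"
      by (rule ext) (simp add: polar_scale 0)
    then show ?thesis
      using qform_has_derivative[of A "k *s p"] by simp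
  qed
  then have "vec.span {p} \<in> sing_points (qform A)"
    using span_in_curve_iff[OF assms(2), of A] assms(3)
    by (auto simp: sing_points_def) (auto simp: vec.span_singleton)
  then show False
    using assms by (simp add: smooth_conic_def)
qed

text \<open>This is the product rule. Where only one member vanishes, the derivative of the product
  is its polar form times a nonzero number, which smoothness keeps nonzero. Where two vanish, every
  summand retains a vanishing factor.\<close>

lemma arr_sing_eq:
  assumes fin: "finite \<A>" and smooth: "\<And>A. A \<in> \<A> \<Longrightarrow> smooth_conic A"
  shows "arr_sing \<A> = {P \<in> proj_plane. \<exists>A\<in>branches \<A> P. \<exists>B\<in>branches \<A> P. A \<noteq> B}"
proof (intro set_eqI iffI)
  fix P
  assume P: "P \<in> arr_sing \<A>"
  let ?F = "\<lambda>x. \<Prod>A\<in>\<A>. qform A x"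
  have "P \<in> proj_plane"
    using P by (simp add: arr_sing_def sing_points_def curve_def)
  then obtain p where p: "p \<noteq> 0" "P = vec.span {p}"
    by (rule proj_planeE)
  have "p \<in> P - {0}"
    using p by (simp add: vec.span_base)
  then have "?F p = 0" and dF: "(?F has_derivative (\<lambda>_. 0)) (at p)"
    using P by (auto simp: arr_sing_def sing_points_def curve_def)
  then obtain A where A: "A \<in> \<A>" "qform A p = 0"
    using fin by auto
  have "\<exists>B\<in>\<A>. B \<noteq> A \<and> qform B p = 0"
  proof (rule ccontr)
    assume "\<not> ?thesis"
    then have R: "(\<Prod>B\<in>\<A> - {A}. qform B p) \<noteq> 0" (is "?R p \<noteq> 0")
      using fin by auto
    have F: "?F = (\<lambda>x. qform A x * (\<Prod>B\<in>\<A> - {A}. qform B x))"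
      using A fin by (simp add: prod.remove)
    have "?R differentiable at p"
      unfolding differentiable_def
      using has_derivative_prod[of "\<A> - {A}" "\<lambda>B. qform B" "\<lambda>B. polar B p" p UNIV] qform_has_derivative
      by blast
    then obtain R' where R': "(?R has_derivative R') (at p)"
      unfolding differentiable_def by blast
    have "(?F has_derivative (\<lambda>h. qform A p * R' h + polar A p h * ?R p)) (at p)"
      unfolding F by (rule has_derivative_mult[OF qform_has_derivative R'])
    then have "(\<lambda>h. qform A p * R' h + polar A p h * ?R p) = (\<lambda>_. 0)"
      using dF by (rule has_derivative_unique)
    then have "polar A p h * ?R p = 0" for h
      using A by (metis (no_types, lifting) add_0 mult_zero_left)
    then have "polar A p = (\<lambda>_. 0)"
      using R by auto
    then show False
      using smooth_conic_polar[OF smooth[OF A(1)] p(1) A(2)] by simp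
  qed
  then show "P \<in> {P \<in> proj_plane. \<exists>A\<in>branches \<A> P. \<exists>B\<in>branches \<A> P. A \<noteq> B}"
    using A p by (auto simp: branches_def span_in_curve_iff span_in_proj_plane)
next
  fix P
  assume "P \<in> {P \<in> proj_plane. \<exists>A\<in>branches \<A> P. \<exists>B\<in>branches \<A> P. A \<noteq> B}"
  then obtain A B where P: "P \<in> proj_plane" and AB: "A \<in> \<A>" "B \<in> \<A>" "A \<noteq> B"
    and PA: "\<And>q. q \<in> P \<Longrightarrow> qform A q = 0" and PB: "\<And>q. q \<in> P \<Longrightarrow> qform B q = 0"
    by (auto simp: branches_def curve_def)
  let ?F = "\<lambda>x. \<Prod>A\<in>\<A>. qform A x"
  have F: "?F = (\<lambda>x. qform A x * (qform B x * (\<Prod>C\<in>\<A> - {A} - {B}. qform C x)))"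
    (is "_ = (\<lambda>x. _ * (_ * ?R x))")
    using AB fin by (simp add: prod.remove[of _ A] prod.remove[of _ B])
  have "(?F has_derivative (\<lambda>_. 0)) (at q)" if q: "q \<in> P" for q
  proof -
    have "?R differentiable at q"
      unfolding differentiable_def
      using has_derivative_prod[of "\<A> - {A} - {B}" "\<lambda>B. qform B" "\<lambda>B. polar B q" q UNIV] qform_has_derivative
      by blast
    then obtain R' where R': "(?R has_derivative R') (at q)"
      unfolding differentiable_def by blast
    have "(?F has_derivative (\<lambda>h. qform A q * (qform B q * R' h + polar B q h * ?R q)
        + polar A q h * (qform B q * ?R q))) (at q)"
      unfolding F by (intro has_derivative_mult qform_has_derivative R')
    then show ?thesis
      by (simp add: PA[OF q] PB[OF q])
  qed
  moreover have "?F q = 0" if "q \<in> P" for q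
    using fun_cong[OF F, of q] PA[OF that] by simp
  ultimately show "P \<in> arr_sing \<A>"
    using P by (simp add: arr_sing_def sing_points_def curve_def)
qed

section \<open>Conics in affine charts and their contact\<close>

lemma const2_sum: "const2 (sum f S) = (\<Sum>i\<in>S. const2 (f i))"
  by (induction S rule: infinite_finite_induct) (simp_all add: const2_add)

text \<open>The Taylor expansion at \<open>p\<close>, which for a quadratic form stops at order
  two.\<close>

lemma local_eq_expand:
  "local_eq A p u v = const2 (qform A p) + lin2 (polar A p u) (polar A p v)
     + X2\<^sup>2 * const2 (qform A u) + X2 * Y2 * const2 (polar A u v) + Y2\<^sup>2 * const2 (qform A v)"
proof -
  have "const2 (A $ i $ j) * (const2 (p $ i) + X2 * const2 (u $ i) + Y2 * const2 (v $ i))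
        * (const2 (p $ j) + X2 * const2 (u $ j) + Y2 * const2 (v $ j))
      = const2 (A $ i $ j * p $ i * p $ j)
        + X2 * const2 (A $ i $ j * (p $ i * u $ j + u $ i * p $ j))
        + Y2 * const2 (A $ i $ j * (p $ i * v $ j + v $ i * p $ j))
        + X2\<^sup>2 * const2 (A $ i $ j * u $ i * u $ j)
        + X2 * Y2 * const2 (A $ i $ j * (u $ i * v $ j + v $ i * u $ j))
        + Y2\<^sup>2 * const2 (A $ i $ j * v $ i * v $ j)" for i j
    unfolding const2_add const2_mult by (simp add: algebra_simps power2_eq_square)
  then show ?thesis
    unfolding local_eq_def Let_def lin2_def qform_def polar_def const2_sum
    by (simp add: sum.distrib sum_distrib_left)
qed

definition lin :: "complex^3 \<Rightarrow> complex^3 \<Rightarrow> complex" where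
  "lin m x = (\<Sum>i\<in>UNIV. m $ i * x $ i)"

lemma lin_add: "lin m (x + y) = lin m x + lin m y"
  and lin_scale: "lin m (k *s x) = k * lin m x"
  unfolding lin_def by (simp_all add: sum.distrib sum_distrib_left algebra_simps)

lemma polar_factorization:
  assumes "\<And>x. qform A x = lin m x * lin n x + \<alpha> * (lin s x)\<^sup>2"
  shows "polar A x y = lin m x * lin n y + lin m y * lin n x + 2 * \<alpha> * lin s x * lin s y"
  using qform_add[of A x y] unfolding assms lin_add
  by (simp add: algebra_simps power2_eq_square)

text \<open>Since \<open>m\<close> and \<open>s\<close> vanish at \<open>p\<close>, they become
  purely linear in the chart, whereas \<open>n\<close> keeps the constant term
  \<open>lin n p\<close>. This is the shape asked for by \<open>quotient_dim_2I\<close>.\<close>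

lemma local_eq_factorization:
  assumes A: "\<And>x. qform A x = lin m x * lin n x + \<alpha> * (lin s x)\<^sup>2"
    and p: "lin m p = 0" "lin s p = 0"
  shows "local_eq A p u v = lin2 (lin m u) (lin m v) * (const2 (lin n p) + lin2 (lin n u) (lin n v))
     + const2 \<alpha> * (lin2 (lin s u) (lin s v))\<^sup>2"
proof -
  have "const2 2 = 2" using const2_add[of 1 1] by simp
  then show ?thesis
    unfolding local_eq_expand polar_factorization[OF A] A lin2_def
    by (simp add: p const2_add const2_mult algebra_simps power2_eq_square)
qed

text \<open>Homogeneous coordinates of the common point of the lines \<open>m = 0\<close> and
  \<open>s = 0\<close>, provided that these differ.\<close>

definition cross :: "complex^3 \<Rightarrow> complex^3 \<Rightarrow> complex^3" where
  "cross m s = vector [m $ 2 * s $ 3 - m $ 3 * s $ 2, m $ 3 * s $ 1 - m $ 1 * s $ 3, m $ 1 * s $ 2 - m $ 2 * s $ 1]"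

lemma lin_cross: "lin m (cross m s) = 0" "lin s (cross m s) = 0"
  by (simp_all add: lin_def cross_def sum_3 algebra_simps)

text \<open>It shows that \<open>m\<close> and \<open>s\<close> stay independent in every chart
  centred at their common point.\<close>

lemma det_cross:
  "det (vector [k *s cross m s, u, v] :: complex^3^3) = k * (lin m u * lin s v - lin m v * lin s u)"
  by (simp add: det_3 cross_def lin_def sum_3 algebra_simps)

text \<open>Both conics touch the line \<open>m = 0\<close> at \<open>p\<close>. Nonzero values of
  \<open>n\<close> and \<open>n'\<close> at \<open>p\<close> make this line the tangent of each, and
  the last inequality supplies the unit for \<open>quotient_dim_2I\<close>.\<close>

lemma tangent_conics:
  assumes A: "\<And>x. qform A x = lin m x * lin n x + \<alpha> * (lin s x)\<^sup>2"
    and B: "\<And>x. qform B x = lin m x * lin n' x + \<beta> * (lin s x)\<^sup>2"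
    and p: "p = cross m s"
    and n: "lin n p \<noteq> 0" "lin n' p \<noteq> 0" "lin n p * \<beta> \<noteq> lin n' p * \<alpha>"
  shows "intersection_mult A B (vec.span {p}) 2" "\<not> transversal_at A B (vec.span {p})"
proof -
  show "intersection_mult A B (vec.span {p}) 2"
    unfolding intersection_mult_def
  proof (intro ballI allI impI)
    fix q u v
    assume "q \<in> vec.span {p}" and det: "det (vector [q, u, v] :: complex^3^3) \<noteq> 0"
    then obtain k where q: "q = k *s p"
      by (auto simp: vec.span_singleton)
    have k: "k \<noteq> 0" and indep: "lin m u * lin s v - lin m v * lin s u \<noteq> 0"
      using det unfolding q p det_cross by auto
    have q0: "lin m q = 0" "lin s q = 0"
      by (simp_all add: q p lin_scale lin_cross)
    show "quotient_dim (ideal2 (local_eq A q u v) (local_eq B q u v)) 2"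
    proof (rule quotient_dim_2I[OF refl refl indep
          local_eq_factorization[OF A q0] local_eq_factorization[OF B q0]])
      show "fps_nth (fps_nth (const2 (lin n q) + lin2 (lin n u) (lin n v)) 0) 0 * \<beta>
          - fps_nth (fps_nth (const2 (lin n' q) + lin2 (lin n' u) (lin n' v)) 0) 0 * \<alpha> \<noteq> 0"
        using n k by (simp add: q lin_scale)
    qed
  qed
  have "polar A p v = lin n p * lin m v" "polar B p v = lin n' p * lin m v" for v
    by (simp_all add: polar_factorization[OF A] polar_factorization[OF B] p lin_cross)
  then show "\<not> transversal_at A B (vec.span {p})"
    using n by (simp add: transversal_at_def tangent_line_span)
qed

text \<open>One chart refutes multiplicity two, as \<open>intersection_mult\<close> asks for all
  charts. The second conclusion keeps nodes out of the set of tacnodes.\<close>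

lemma transversal_conics:
  assumes p: "qform A p = 0" "qform B p = 0"
    and det: "det (vector [p, u, v] :: complex^3^3) \<noteq> 0"
    and jac: "polar A p u * polar B p v \<noteq> polar A p v * polar B p u"
  shows "transversal_at A B (vec.span {p})" "\<not> intersection_mult A B (vec.span {p}) 2"
proof -
  \<comment> \<open>The combination of \<open>u\<close> and \<open>v\<close> on the tangent line of
    \<open>A\<close>; by \<open>jac\<close> it is off that of \<open>B\<close>.\<close>
  define w where "w = polar A p v *s u + (- polar A p u) *s v"
  have "polar A p w = 0" "polar B p w \<noteq> 0"
    using jac unfolding w_def polar_add_scale by (simp_all add: algebra_simps)
  then show "transversal_at A B (vec.span {p})"
    unfolding transversal_at_def tangent_line_span by auto
  have nth: "fps_nth (fps_nth (local_eq C p u v) 0) 0 = qform C p"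
    "fps_nth (fps_nth (local_eq C p u v) 0) (Suc 0) = polar C p u"
    "fps_nth (fps_nth (local_eq C p u v) (Suc 0)) 0 = polar C p v" for C
    unfolding local_eq_expand
    by (simp_all add: X2_def Y2_def const2_def power2_eq_square fps_mult_nth)
  have "\<not> quotient_dim (ideal2 (local_eq A p u v) (local_eq B p u v)) 2"
    by (rule quotient_dim_transversal) (use p jac in \<open>simp_all add: nth\<close>)
  then show "\<not> intersection_mult A B (vec.span {p}) 2"
    using det vec.span_base[of p "{p}"] unfolding intersection_mult_def by blast
qed


section \<open>Conics bitangent to a fixed conic\<close>

lemma vec3_eq_iff: "x = y \<longleftrightarrow> x $ 1 = y $ 1 \<and> x $ 2 = y $ 2 \<and> x $ 3 = y $ 3" for x y :: "complex^3"
  by (simp add: vec_eq_iff forall_3)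

text \<open>As \<open>m\<close> and \<open>s\<close> annihilate \<open>q\<close>, the triple product
  identity makes the vector product of \<open>q\<close> and \<open>cross m s\<close> zero, so the
  two are proportional.\<close>

lemma span_cross_unique:
  assumes "lin m q = 0" "lin s q = 0" "q \<noteq> 0" "cross m s \<noteq> 0"
  shows "vec.span {q} = vec.span {cross m s}"
proof -
  let ?c = "cross m s"
  have m: "m $ 1 * q $ 1 + m $ 2 * q $ 2 + m $ 3 * q $ 3 = 0"
    and s: "s $ 1 * q $ 1 + s $ 2 * q $ 2 + s $ 3 * q $ 3 = 0"
    using assms(1,2) by (simp_all add: lin_def sum_3)
  have c: "?c $ 1 = m $ 2 * s $ 3 - m $ 3 * s $ 2" "?c $ 2 = m $ 3 * s $ 1 - m $ 1 * s $ 3"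
    "?c $ 3 = m $ 1 * s $ 2 - m $ 2 * s $ 1"
    by (simp_all add: cross_def)
  have par: "q $ 1 * ?c $ 2 = q $ 2 * ?c $ 1" "q $ 1 * ?c $ 3 = q $ 3 * ?c $ 1"
    "q $ 2 * ?c $ 3 = q $ 3 * ?c $ 2"
    unfolding c using m s by algebra+
  have "\<exists>k. q = k *s ?c"
  proof -
    consider "?c $ 1 \<noteq> 0" | "?c $ 2 \<noteq> 0" | "?c $ 3 \<noteq> 0"
      using assms(4) by (auto simp: vec3_eq_iff)
    then show ?thesis
    proof cases
      case 1
      then have "q = (q $ 1 / ?c $ 1) *s ?c"
        using par by (simp add: vec3_eq_iff field_simps)
      then show ?thesis by blast
    next
      case 2
      then have "q = (q $ 2 / ?c $ 2) *s ?c"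
        using par by (simp add: vec3_eq_iff field_simps)
      then show ?thesis by blast
    next
      case 3
      then have "q = (q $ 3 / ?c $ 3) *s ?c"
        using par by (simp add: vec3_eq_iff field_simps)
      then show ?thesis by blast
    qed
  qed
  then obtain k where k: "q = k *s ?c" ..
  with assms(3) have "k \<noteq> 0" by auto
  with k show ?thesis by (simp add: span_scale)
qed

section \<open>The fixed conic and the family bitangent to it\<close>

definition base_conic :: "complex^3^3" where
  "base_conic = vector [vector [0, -4, 0], vector [0, 0, 0], vector [0, 0, 1]]"

definition tangent_conic :: "complex \<Rightarrow> complex \<Rightarrow> complex^3^3" where
  "tangent_conic u v = vector [vector [v^4, 2 * u\<^sup>2 * v\<^sup>2 + 1, v\<^sup>2], vector [0, u^4, u\<^sup>2], vector [0, 0, 0]]"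

lemma qform_base: "qform base_conic x = (x $ 3)\<^sup>2 - 4 * x $ 1 * x $ 2"
  by (simp add: qform_def sum_3 base_conic_def power2_eq_square)

lemma qform_tangent:
  "qform (tangent_conic u v) x =
     (v\<^sup>2 * x $ 1 + u\<^sup>2 * x $ 2)\<^sup>2 + x $ 3 * (v\<^sup>2 * x $ 1 + u\<^sup>2 * x $ 2) + x $ 1 * x $ 2"
  by (simp add: qform_def sum_3 tangent_conic_def power2_eq_square power4_eq_xxxx algebra_simps)

lemma polar_base: "polar base_conic x h = 2 * x $ 3 * h $ 3 - 4 * (x $ 1 * h $ 2 + h $ 1 * x $ 2)"
  by (simp add: polar_def sum_3 base_conic_def)

lemma polar_tangent:
  "polar (tangent_conic u v) x h =
     (2 * (v\<^sup>2 * x $ 1 + u\<^sup>2 * x $ 2) + x $ 3) * (v\<^sup>2 * h $ 1 + u\<^sup>2 * h $ 2)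
     + (v\<^sup>2 * x $ 1 + u\<^sup>2 * x $ 2) * h $ 3 + x $ 1 * h $ 2 + h $ 1 * x $ 2"
  by (simp add: polar_def sum_3 tangent_conic_def power2_eq_square power4_eq_xxxx algebra_simps)

lemma smooth_base: "smooth_conic base_conic"
proof (rule smooth_conicI)
  fix p assume p: "\<And>h. polar base_conic p h = 0"
  show "p = 0"
    using p[of "vector [1, 0, 0]"] p[of "vector [0, 1, 0]"] p[of "vector [0, 0, 1]"]
    by (simp add: polar_base vec3_eq_iff)
qed

text \<open>The partial derivative in \<open>z\<close> gives \<open>m = 0\<close>. The other two
  then give \<open>x = - u^2 z\<close> and \<open>y = - v^2 z\<close>, which turns
  \<open>m = 0\<close> into \<open>2 u^2 v^2 z = 0\<close>.\<close>

lemma smooth_tangent: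
  assumes "u \<noteq> 0" "v \<noteq> 0"
  shows "smooth_conic (tangent_conic u v)"
proof (rule smooth_conicI)
  fix p assume p: "\<And>h. polar (tangent_conic u v) p h = 0"
  have 3: "v\<^sup>2 * p $ 1 + u\<^sup>2 * p $ 2 = 0"
    using p[of "vector [0, 0, 1]"] by (simp add: polar_tangent)
  have "v\<^sup>2 * p $ 3 + p $ 2 = 0" "u\<^sup>2 * p $ 3 + p $ 1 = 0"
    using 3 p[of "vector [1, 0, 0]", unfolded polar_tangent vector_3]
      p[of "vector [0, 1, 0]", unfolded polar_tangent vector_3] by algebra+
  then have 12: "p $ 2 = - (v\<^sup>2 * p $ 3)" "p $ 1 = - (u\<^sup>2 * p $ 3)"
    by (metis add.commute eq_neg_iff_add_eq_0)+
  have "2 * u\<^sup>2 * v\<^sup>2 * p $ 3 = 0"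
    using 3 unfolding 12 by (simp add: algebra_simps)
  then show "p = 0"
    using assms 12 by (simp add: vec3_eq_iff)
qed

text \<open>
  The pencil of \<open>Q = z\<^sup>2 - 4xy\<close> and \<open>C = m\<^sup>2 + zm + xy\<close> contains the double line
  \<open>Q + 4C = (z + 2m)\<^sup>2\<close> and the pair of common tangents, \<open>C + u\<^sup>2v\<^sup>2Q\<close>.
\<close>

lemma base_tangent_contact:
  assumes uv: "u \<noteq> 0" "v \<noteq> 0" "4 * u\<^sup>2 * v\<^sup>2 \<noteq> 1"
  obtains p p' where "p \<noteq> 0" "p' \<noteq> 0" "vec.span {p} \<noteq> vec.span {p'}"
    "\<forall>q\<in>{p, p'}. qform (tangent_conic u v) q = 0 \<and> qform base_conic q = 0
       \<and> intersection_mult (tangent_conic u v) base_conic (vec.span {q}) 2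
       \<and> \<not> transversal_at (tangent_conic u v) base_conic (vec.span {q})"
    "\<forall>q. q \<noteq> 0 \<and> qform (tangent_conic u v) q = 0 \<and> qform base_conic q = 0
       \<longrightarrow> vec.span {q} \<in> {vec.span {p}, vec.span {p'}}"
proof -
  let ?C = "tangent_conic u v"
  \<comment> \<open>The determinant, up to sign, for recovering both conics from the two degenerate
    members of the pencil.\<close>
  define k where "k = 4 * u\<^sup>2 * v\<^sup>2 - 1"
  define s :: "complex^3" where "s = vector [2 * v\<^sup>2, 2 * u\<^sup>2, 1]"
  \<comment> \<open>The tangent line of the fixed conic at
    \<open>[\<sigma>^2 : 1 : 2 \<sigma>]\<close>.\<close>
  define t :: "complex \<Rightarrow> complex^3" where "t \<sigma> = vector [1, \<sigma>\<^sup>2, - \<sigma>]" for \<sigma>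
  \<comment> \<open>The two parameters are the distinct roots of \<open>v^2 X^2 + X + u^2\<close>,
    so they belong to the points of the fixed conic on the chord \<open>s\<close>.\<close>
  define R where "R \<sigma> \<sigma>' \<longleftrightarrow> v\<^sup>2 * (\<sigma> + \<sigma>') = - 1 \<and> v\<^sup>2 * \<sigma> * \<sigma>' = u\<^sup>2 \<and> \<sigma> \<noteq> \<sigma>'" for \<sigma> \<sigma>'
  have k: "k \<noteq> 0" using uv by (simp add: k_def)
  \<comment> \<open>A square root of the discriminant of that quadratic.\<close>
  define \<delta> where "\<delta> = csqrt (1 - 4 * u\<^sup>2 * v\<^sup>2)"
  have \<delta>: "\<delta>\<^sup>2 = 1 - 4 * u\<^sup>2 * v\<^sup>2"
    unfolding \<delta>_def by (rule power2_csqrt)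
  then have \<delta>0: "\<delta> \<noteq> 0" using uv by auto
  define \<sigma> where "\<sigma> = (- 1 + \<delta>) / (2 * v\<^sup>2)"
  define \<sigma>' where "\<sigma>' = (- 1 - \<delta>) / (2 * v\<^sup>2)"
  have R: "R \<sigma> \<sigma>'"
  proof -
    have "4 * v\<^sup>2 * (v\<^sup>2 * \<sigma> * \<sigma>') = (- 1 + \<delta>) * (- 1 - \<delta>)"
      using uv by (simp add: \<sigma>_def \<sigma>'_def power2_eq_square)
    also have "\<dots> = 4 * v\<^sup>2 * u\<^sup>2"
      using \<delta> by (simp add: algebra_simps power2_eq_square)
    finally have "v\<^sup>2 * \<sigma> * \<sigma>' = u\<^sup>2" using uv by simp
    moreover have "v\<^sup>2 * (\<sigma> + \<sigma>') = - 1" "\<sigma> \<noteq> \<sigma>'"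
      using uv \<delta>0 by (simp_all add: \<sigma>_def \<sigma>'_def field_simps)
    ultimately show ?thesis by (simp add: R_def)
  qed
  then have R': "R \<sigma>' \<sigma>" by (auto simp: R_def algebra_simps)
  have pair: "v^4 * lin (t a) x * lin (t b) x = qform ?C x + u\<^sup>2 * v\<^sup>2 * qform base_conic x"
    if "R a b" for a b x
  proof -
    have "v\<^sup>2 * (a + b) = - 1" "v\<^sup>2 * a * b = u\<^sup>2" using that by (simp_all add: R_def)
    then show ?thesis
      unfolding lin_def t_def qform_tangent qform_base sum_3 vector_3 by algebra
  qed
  have dbl: "(lin s x)\<^sup>2 = qform base_conic x + 4 * qform ?C x" for x
    unfolding lin_def s_def qform_tangent qform_base sum_3 vector_3 by algebra
  have cross: "cross (t a) s = (v\<^sup>2 * (b - a)) *s vector [a\<^sup>2, 1, 2 * a]" if "R a b" for a b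
  proof -
    have ab: "v\<^sup>2 * (a + b) = - 1" "v\<^sup>2 * a * b = u\<^sup>2" using that by (simp_all add: R_def)
    have "a\<^sup>2 + 2 * u\<^sup>2 * a = v\<^sup>2 * (b - a) * a\<^sup>2" "- 2 * v\<^sup>2 * a - 1 = v\<^sup>2 * (b - a)"
      "2 * u\<^sup>2 - 2 * v\<^sup>2 * a\<^sup>2 = v\<^sup>2 * (b - a) * (2 * a)"
      using ab by algebra+
    then show ?thesis
      by (simp add: cross_def t_def s_def vec3_eq_iff algebra_simps)
  qed
  have ne: "cross (t a) s \<noteq> 0" if "R a b" for a b
    using that uv unfolding cross[OF that] by (auto simp: R_def vec3_eq_iff)
  have contact: "intersection_mult ?C base_conic (vec.span {cross (t a) s}) 2"
    "\<not> transversal_at ?C base_conic (vec.span {cross (t a) s})"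
    "qform ?C (cross (t a) s) = 0" "qform base_conic (cross (t a) s) = 0"
    if R: "R a b" for a b
  proof -
    let ?p = "cross (t a) s"
    \<comment> \<open>Solving the identities \<open>pair\<close> and \<open>dbl\<close> for the two
      conics puts both into the form of \<open>tangent_conics\<close>, with tangent
      \<open>t a\<close> and chord \<open>s\<close>.\<close>
    let ?n = "(- (v^4) / k) *s t b" and ?n' = "(4 * v^4 / k) *s t b"
    let ?\<alpha> = "u\<^sup>2 * v\<^sup>2 / k" and ?\<beta> = "- 1 / k"
    have lin_smult: "lin (c *s m) x = c * lin m x" for c m x
      by (simp add: lin_def sum_distrib_left mult.assoc)
    have C: "qform ?C x = lin (t a) x * lin ?n x + ?\<alpha> * (lin s x)\<^sup>2" for x
    proof -
      have "k * qform ?C x = - (v^4 * lin (t a) x * lin (t b) x) + u\<^sup>2 * v\<^sup>2 * (lin s x)\<^sup>2"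
        unfolding pair[OF R] dbl k_def by algebra
      then show ?thesis using k unfolding lin_smult by (simp add: field_simps)
    qed
    have Q: "qform base_conic x = lin (t a) x * lin ?n' x + ?\<beta> * (lin s x)\<^sup>2" for x
    proof -
      have "k * qform base_conic x = 4 * (v^4 * lin (t a) x * lin (t b) x) - (lin s x)\<^sup>2"
        unfolding pair[OF R] dbl k_def by algebra
      then show ?thesis using k unfolding lin_smult by (simp add: field_simps)
    qed
    \<comment> \<open>The other common tangent misses this contact point because the roots
      differ.\<close>
    have "lin (t b) ?p = v\<^sup>2 * (b - a) * (b - a)\<^sup>2"
      unfolding cross[OF R] by (simp add: lin_def t_def sum_3 power2_eq_square algebra_simps)
    then have tb: "lin (t b) ?p \<noteq> 0"
      using uv R by (auto simp: R_def)
    have "lin ?n ?p \<noteq> 0" "lin ?n' ?p \<noteq> 0"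
      unfolding lin_smult using tb k uv by simp_all
    moreover have "lin ?n ?p * ?\<beta> \<noteq> lin ?n' ?p * ?\<alpha>"
    proof -
      have "lin ?n' ?p * ?\<alpha> - lin ?n ?p * ?\<beta> = v^4 * lin (t b) ?p * (4 * u\<^sup>2 * v\<^sup>2 - 1) / k\<^sup>2"
        unfolding lin_smult using k by (simp add: field_simps power2_eq_square)
      also have "\<dots> \<noteq> 0"
        using tb k uv by simp
      finally show ?thesis by (metis right_minus_eq)
    qed
    ultimately show "intersection_mult ?C base_conic (vec.span {?p}) 2"
      "\<not> transversal_at ?C base_conic (vec.span {?p})"
      using tangent_conics[OF C Q refl] by blast+
    show "qform ?C ?p = 0" "qform base_conic ?p = 0"
      unfolding C Q by (simp_all add: lin_cross)
  qed
  show thesis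
  proof (rule that[of "cross (t \<sigma>) s" "cross (t \<sigma>') s"])
    show "vec.span {cross (t \<sigma>) s} \<noteq> vec.span {cross (t \<sigma>') s}"
    proof
      assume "vec.span {cross (t \<sigma>) s} = vec.span {cross (t \<sigma>') s}"
      then have "vec.span {vector [\<sigma>\<^sup>2, 1, 2 * \<sigma>]} = vec.span {vector [\<sigma>'\<^sup>2, 1, 2 * \<sigma>'] :: complex^3}"
        unfolding cross[OF R] cross[OF R'] using uv R by (subst (asm) (1 2) span_scale) (auto simp: R_def)
      moreover have "vector [\<sigma>\<^sup>2, 1, 2 * \<sigma>] \<in> vec.span {vector [\<sigma>\<^sup>2, 1, 2 * \<sigma>] :: complex^3}"
        by (rule vec.span_base) simp
      ultimately obtain c where "vector [\<sigma>\<^sup>2, 1, 2 * \<sigma>] = c *s (vector [\<sigma>'\<^sup>2, 1, 2 * \<sigma>'] :: complex^3)"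
        by (auto simp: vec.span_singleton)
      then show False
        using R by (auto simp: vec3_eq_iff R_def)
    qed
    show "\<forall>q. q \<noteq> 0 \<and> qform ?C q = 0 \<and> qform base_conic q = 0
        \<longrightarrow> vec.span {q} \<in> {vec.span {cross (t \<sigma>) s}, vec.span {cross (t \<sigma>') s}}"
    proof (intro allI impI)
      fix q assume "q \<noteq> 0 \<and> qform ?C q = 0 \<and> qform base_conic q = 0"
      then have q: "q \<noteq> 0" "qform ?C q = 0" "qform base_conic q = 0" by auto
      \<comment> \<open>A common point of the two conics lies on every member of the pencil, in
        particular on the double chord and on the pair of tangents.\<close>
      have s: "lin s q = 0" using dbl[of q] q by simp
      have "lin (t \<sigma>) q = 0 \<or> lin (t \<sigma>') q = 0"
        using pair[OF R, of q] q uv by simp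
      then show "vec.span {q} \<in> {vec.span {cross (t \<sigma>) s}, vec.span {cross (t \<sigma>') s}}"
        using span_cross_unique[OF _ s q(1) ne[OF R]] span_cross_unique[OF _ s q(1) ne[OF R']] by blast
    qed
  qed (use ne[OF R] ne[OF R'] contact[OF R] contact[OF R'] in auto)
qed

text \<open>On the fixed conic the other two equations become \<open>z = - 2 m\<close> and
  \<open>z = - 2 m'\<close>, so \<open>m = m'\<close>. This leaves one parameter \<open>t\<close>,
  and the first conic gives \<open>t^2 (d^2 + A B) = 0\<close>, where \<open>A\<close> and
  \<open>B\<close> are the differences of the squares.\<close>

lemma base_tangent_tangent_disjoint:
  fixes u v u' v' :: complex
  defines "d \<equiv> u\<^sup>2 * v'\<^sup>2 - v\<^sup>2 * u'\<^sup>2"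
  assumes "v\<^sup>2 \<noteq> v'\<^sup>2" "d\<^sup>2 + (v\<^sup>2 - v'\<^sup>2) * (u\<^sup>2 - u'\<^sup>2) \<noteq> 0"
    and "qform (tangent_conic u v) q = 0" "qform (tangent_conic u' v') q = 0" "qform base_conic q = 0"
  shows "q = 0"
proof -
  let ?A = "v\<^sup>2 - v'\<^sup>2" and ?B = "u\<^sup>2 - u'\<^sup>2"
  have L: "q $ 3 = - 2 * (v\<^sup>2 * q $ 1 + u\<^sup>2 * q $ 2)"
    if "qform (tangent_conic u v) q = 0" for u v
  proof -
    have "(q $ 3 + 2 * (v\<^sup>2 * q $ 1 + u\<^sup>2 * q $ 2))\<^sup>2 = qform base_conic q + 4 * qform (tangent_conic u v) q"
      unfolding qform_tangent qform_base by algebra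
    then have "q $ 3 + 2 * (v\<^sup>2 * q $ 1 + u\<^sup>2 * q $ 2) = 0"
      using that assms by simp
    then show ?thesis by algebra
  qed
  note 3 = L[OF assms(4)] L[OF assms(5)]
  have "?A \<noteq> 0" using assms(2) by simp
  then obtain t where "?A * t = - (q $ 2)"
    by (metis nonzero_mult_div_cancel_left times_divide_eq_right)
  then have 2: "q $ 2 = - ?A * t"
    by algebra
  have "?A * q $ 1 + ?B * q $ 2 = 0"
    using 3 by algebra
  then have "?A * (q $ 1 - ?B * t) = 0"
    unfolding 2 by algebra
  then have 1: "q $ 1 = ?B * t"
    using assms(2) by simp
  have "t\<^sup>2 * (d\<^sup>2 + ?A * ?B) = 0"
    using assms(4) unfolding qform_tangent 3(1) 1 2 d_def by algebra
  then have "t = 0" using assms(3) by simp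
  then show "q = 0" using 1 2 3 by (simp add: vec3_eq_iff)
qed

text \<open>The first line is the common tangent \<open>z + m + m' = 0\<close>; the second is the
  one whose square occurs in both factorizations below.\<close>

definition contact_point :: "complex \<Rightarrow> complex \<Rightarrow> complex \<Rightarrow> complex \<Rightarrow> complex^3" where
  "contact_point u v u' v' =
     cross (vector [v\<^sup>2 + v'\<^sup>2, u\<^sup>2 + u'\<^sup>2, 1]) (vector [v * v', u * u', 0])"

text \<open>The common point on the line \<open>m = m'\<close> residual to
  \<open>[0 : 0 : 1]\<close>; \<open>m\<close> and \<open>m'\<close> both take the value
  \<open>d^2\<close> there.\<close>

definition node_point :: "complex \<Rightarrow> complex \<Rightarrow> complex \<Rightarrow> complex \<Rightarrow> complex^3" where
  "node_point u v u' v' =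
     (let A = v\<^sup>2 - v'\<^sup>2; B = u\<^sup>2 - u'\<^sup>2; d = u\<^sup>2 * v'\<^sup>2 - v\<^sup>2 * u'\<^sup>2
      in vector [B * d, - A * d, A * B - d\<^sup>2])"

text \<open>The product \<open>(z + m + m') m\<close> exceeds the equation by
  \<open>m m' - x y\<close>, and the assumption turns this into the square of
  \<open>v v' x + u u' y\<close>.\<close>

lemma tangent_tangent_factorization:
  assumes "(u * v' - v * u')\<^sup>2 = 1"
  shows "qform (tangent_conic u v) x =
    lin (vector [v\<^sup>2 + v'\<^sup>2, u\<^sup>2 + u'\<^sup>2, 1]) x * lin (vector [v\<^sup>2, u\<^sup>2, 0]) x
    + (- 1) * (lin (vector [v * v', u * u', 0]) x)\<^sup>2"
  unfolding lin_def qform_tangent sum_3 vector_3 using assms by algebra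

lemma tangent_tangent_factorization':
  assumes "(u * v' - v * u')\<^sup>2 = 1"
  shows "qform (tangent_conic u' v') x =
    lin (vector [v\<^sup>2 + v'\<^sup>2, u\<^sup>2 + u'\<^sup>2, 1]) x * lin (vector [v'\<^sup>2, u'\<^sup>2, 0]) x
    + (- 1) * (lin (vector [v * v', u * u', 0]) x)\<^sup>2"
  unfolding lin_def qform_tangent sum_3 vector_3 using assms by algebra

text \<open>At the contact point \<open>m\<close> and \<open>m'\<close> have the values
  \<open>u v D\<close> and \<open>- u' v' D\<close> with \<open>D = u v' - v u'\<close>; they differ
  as \<open>u v + u' v'\<close> is nonzero.\<close>

lemma contact_point_tangent:
  assumes d: "(u * v' - v * u')\<^sup>2 = 1" and "u \<noteq> 0" "v \<noteq> 0" "u' \<noteq> 0" "v' \<noteq> 0" "u * v + u' * v' \<noteq> 0"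
  defines "P \<equiv> vec.span {contact_point u v u' v'}"
  shows "intersection_mult (tangent_conic u v) (tangent_conic u' v') P 2"
    "\<not> transversal_at (tangent_conic u v) (tangent_conic u' v') P"
proof -
  let ?p = "contact_point u v u' v'" and ?d = "u * v' - v * u'"
  have d0: "?d \<noteq> 0" using d by auto
  have n: "lin (vector [v\<^sup>2, u\<^sup>2, 0]) ?p = u * v * ?d" "lin (vector [v'\<^sup>2, u'\<^sup>2, 0]) ?p = - (u' * v' * ?d)"
    by (simp_all add: contact_point_def cross_def lin_def sum_3 power2_eq_square algebra_simps)
  have "lin (vector [v\<^sup>2, u\<^sup>2, 0]) ?p * (- 1) - lin (vector [v'\<^sup>2, u'\<^sup>2, 0]) ?p * (- 1) = - ?d * (u * v + u' * v')"
    unfolding n by (simp add: algebra_simps)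
  moreover have "- ?d * (u * v + u' * v') \<noteq> 0"
    using assms d0 by simp
  ultimately have "lin (vector [v\<^sup>2, u\<^sup>2, 0]) ?p * (- 1) \<noteq> lin (vector [v'\<^sup>2, u'\<^sup>2, 0]) ?p * (- 1)"
    by auto
  moreover have "lin (vector [v\<^sup>2, u\<^sup>2, 0]) ?p \<noteq> 0" "lin (vector [v'\<^sup>2, u'\<^sup>2, 0]) ?p \<noteq> 0"
    unfolding n using assms d0 by simp_all
  ultimately show "intersection_mult (tangent_conic u v) (tangent_conic u' v') P 2"
    "\<not> transversal_at (tangent_conic u v) (tangent_conic u' v') P"
    unfolding P_def
    using tangent_conics[OF tangent_tangent_factorization[OF d] tangent_tangent_factorization'[OF d]
        contact_point_def] by blast+
qed

text \<open>In a chart spanned by two coordinate vectors the Jacobian is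
  \<open>A d^2 (d^2 + A B)\<close> up to sign.\<close>

lemma node_point_transversal:
  fixes u v u' v' :: complex
  defines "d \<equiv> u\<^sup>2 * v'\<^sup>2 - v\<^sup>2 * u'\<^sup>2"
  defines "P \<equiv> vec.span {node_point u v u' v'}"
  assumes "v\<^sup>2 \<noteq> v'\<^sup>2" "d \<noteq> 0" "d\<^sup>2 + (v\<^sup>2 - v'\<^sup>2) * (u\<^sup>2 - u'\<^sup>2) \<noteq> 0"
  shows "transversal_at (tangent_conic u v) (tangent_conic u' v') P"
    "\<not> intersection_mult (tangent_conic u v) (tangent_conic u' v') P 2"
proof -
  let ?A = "v\<^sup>2 - v'\<^sup>2" and ?B = "u\<^sup>2 - u'\<^sup>2" and ?C = "tangent_conic u v" and ?C' = "tangent_conic u' v'"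
  let ?p = "node_point u v u' v'" and ?e3 = "vector [0, 0, 1] :: complex^3" and ?e1 = "vector [1, 0, 0] :: complex^3"
  have p: "?p $ 1 = ?B * d" "?p $ 2 = - ?A * d" "?p $ 3 = ?A * ?B - d\<^sup>2"
    by (simp_all add: node_point_def d_def Let_def algebra_simps)
  have "qform ?C ?p = 0" "qform ?C' ?p = 0"
    unfolding qform_tangent p d_def by algebra+
  moreover have "det (vector [?p, ?e3, ?e1] :: complex^3^3) = - ?A * d"
    unfolding det_3 vector_3 p by algebra
  then have "det (vector [?p, ?e3, ?e1] :: complex^3^3) \<noteq> 0"
    using assms by simp
  moreover have "polar ?C ?p ?e3 * polar ?C' ?p ?e1 - polar ?C ?p ?e1 * polar ?C' ?p ?e3
      = - ?A * d\<^sup>2 * (d\<^sup>2 + ?A * ?B)"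
    unfolding polar_tangent vector_3 p d_def by algebra
  then have "polar ?C ?p ?e3 * polar ?C' ?p ?e1 \<noteq> polar ?C ?p ?e1 * polar ?C' ?p ?e3"
    using assms by auto
  ultimately show "transversal_at ?C ?C' P" "\<not> intersection_mult ?C ?C' P 2"
    unfolding P_def using transversal_conics by blast+
qed

text \<open>At \<open>[0 : 0 : 1]\<close> the polar form of each conic is its form \<open>m\<close>,
  so the tangents are \<open>m = 0\<close> and \<open>m' = 0\<close>.\<close>

lemma vertex_transversal:
  assumes "u\<^sup>2 * v'\<^sup>2 \<noteq> v\<^sup>2 * u'\<^sup>2"
  shows "transversal_at (tangent_conic u v) (tangent_conic u' v') (vec.span {vector [0, 0, 1]})"
  by (rule transversal_conics(1)[where u = "vector [1, 0, 0]" and v = "vector [0, 1, 0]"])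
     (use assms in \<open>simp_all add: qform_tangent polar_tangent det_3 mult.commute\<close>)

text \<open>
  The difference of the two equations is the product of \<open>m - m'\<close>, whose zero line joins the vertex
  to the node, and of \<open>z + m + m'\<close>, whose zero line is the common tangent at the contact point.
\<close>

lemma tangent_tangent_intersection:
  fixes u v u' v' :: complex
  defines "d \<equiv> u\<^sup>2 * v'\<^sup>2 - v\<^sup>2 * u'\<^sup>2"
  assumes "v\<^sup>2 \<noteq> v'\<^sup>2" "d \<noteq> 0" "(u * v' - v * u')\<^sup>2 = 1" "u * u' \<noteq> 0"
    and q: "q \<noteq> 0" "qform (tangent_conic u v) q = 0" "qform (tangent_conic u' v') q = 0"
  shows "vec.span {q} \<in> {vec.span {vector [0, 0, 1]}, vec.span {node_point u v u' v'},
           vec.span {contact_point u v u' v'}}"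
proof -
  let ?A = "v\<^sup>2 - v'\<^sup>2" and ?B = "u\<^sup>2 - u'\<^sup>2"
  let ?m = "vector [v\<^sup>2 + v'\<^sup>2, u\<^sup>2 + u'\<^sup>2, 1] :: complex^3" and ?s = "vector [v * v', u * u', 0] :: complex^3"
  have "(?A * q $ 1 + ?B * q $ 2) * lin ?m q = qform (tangent_conic u v) q - qform (tangent_conic u' v') q"
    unfolding lin_def qform_tangent sum_3 vector_3 by algebra
  then consider "lin ?m q = 0" | "?A * q $ 1 + ?B * q $ 2 = 0"
    using q by auto
  then show ?thesis
  proof cases
    case 1
    then have "lin ?s q = 0"
      using tangent_tangent_factorization[OF assms(4), of q] q by simp
    moreover have "cross ?m ?s \<noteq> 0"
      using assms by (simp add: cross_def vec3_eq_iff)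
    ultimately show ?thesis
      unfolding contact_point_def using span_cross_unique[OF 1 _ q(1)] by blast
  next
    case 2
    have "?A \<noteq> 0" using assms(2) by simp
    then obtain t where "?A * t = - (q $ 2)"
      by (metis nonzero_mult_div_cancel_left times_divide_eq_right)
    then have q2: "q $ 2 = - ?A * t"
      by algebra
    have "?A * (q $ 1 - ?B * t) = 0"
      using 2 unfolding q2 by algebra
    then have q1: "q $ 1 = ?B * t"
      using assms(2) by simp
    \<comment> \<open>On the line \<open>m = m'\<close> the equation splits: \<open>t = 0\<close> is
      the vertex and the other factor is the node.\<close>
    have t: "t * (t * (d\<^sup>2 - ?A * ?B) + d * q $ 3) = 0"
      using q(2) unfolding qform_tangent q1 q2 d_def by algebra
    show ?thesis
    proof (cases "t = 0")
      case True
      then have "q = q $ 3 *s vector [0, 0, 1]"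
        by (simp add: vec3_eq_iff q1 q2)
      moreover from this q(1) have "q $ 3 \<noteq> 0"
        by auto
      ultimately show ?thesis
        by (metis span_scale insertI1)
    next
      case False
      then have "t * (d\<^sup>2 - ?A * ?B) + d * q $ 3 = 0"
        using t by simp
      then have "d * q $ 3 = t * (?A * ?B - d\<^sup>2)"
        by algebra
      then have "q $ 3 = t / d * (?A * ?B - d\<^sup>2)"
        using assms(3) by (simp add: field_simps)
      then have "q = (t / d) *s node_point u v u' v'"
        using assms(3) by (simp add: vec3_eq_iff q1 q2 node_point_def Let_def d_def)
          (simp add: algebra_simps)
      then show ?thesis
        using False assms(3) by (simp add: span_scale)
    qed
  qed
qed


section \<open>The arrangement\<close>

lemma transversal_at_commute: "transversal_at A B P \<longleftrightarrow> transversal_at B A P"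
  by (auto simp: transversal_at_def)

lemma intersection_mult_commute: "intersection_mult A B P n \<longleftrightarrow> intersection_mult B A P n"
  by (simp add: intersection_mult_def ideal2_commute)

lemma nodeI:
  assumes "P \<in> arr_sing \<A>" "branches \<A> P = {A, B}" "A \<noteq> B"
    and "transversal_at A B P" "\<not> intersection_mult A B P 2"
  shows "P \<in> nodes \<A> - tacnodes \<A> - ordinary_triple_points \<A>"
  using assms
  by (auto simp: nodes_def tacnodes_def ordinary_triple_points_def doubleton_eq_iff intersection_mult_commute)

lemma tacnodeI:
  assumes "P \<in> arr_sing \<A>" "branches \<A> P = {A, B}" "A \<noteq> B"
    and "\<not> transversal_at A B P" "intersection_mult A B P 2"
  shows "P \<in> tacnodes \<A> - nodes \<A> - ordinary_triple_points \<A>"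
  using assms
  by (auto simp: nodes_def tacnodes_def ordinary_triple_points_def doubleton_eq_iff transversal_at_commute)

lemma ordinary_triple_pointI:
  assumes "P \<in> arr_sing \<A>" "branches \<A> P = {A, B, C}" "A \<noteq> B" "A \<noteq> C" "B \<noteq> C"
    and "transversal_at A B P" "transversal_at A C P" "transversal_at B C P"
  shows "P \<in> ordinary_triple_points \<A> - nodes \<A> - tacnodes \<A>"
proof -
  have card: "card (branches \<A> P) = 3" using assms by simp
  have "branches \<A> P \<noteq> {D, E}" for D E
  proof
    assume "branches \<A> P = {D, E}"
    with card have "card {D, E} = 3" by simp
    then show False by (simp add: card_insert_if split: if_splits)
  qed
  then have "P \<notin> nodes \<A>" "P \<notin> tacnodes \<A>"
    by (auto simp: nodes_def tacnodes_def)
  moreover have "P \<in> ordinary_triple_points \<A>"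
    using assms card by (auto simp: ordinary_triple_points_def pairwise_def transversal_at_commute)
  ultimately show ?thesis by simp
qed

text \<open>An element of \<open>X\<close> lies in the cover but not in \<open>C\<close> or
  \<open>T\<close>, hence in \<open>N\<close>; the same holds for \<open>Y\<close> and
  \<open>Z\<close>. So classifying every singular point once determines all three sets.\<close>

lemma disjoint_cover_eq:
  assumes "X \<subseteq> N \<union> C \<union> T" "Y \<subseteq> N \<union> C \<union> T" "Z \<subseteq> N \<union> C \<union> T"
    and "N \<subseteq> X - Y - Z" "C \<subseteq> Y - X - Z" "T \<subseteq> Z - X - Y"
  shows "X = N" "Y = C" "Z = T"
  using assms by blast+

theorem proposition3p8:
  shows "\<exists>\<A> :: (complex^3^3) set.
    conic_arrangement \<A> \<and> card \<A> = 4 \<and>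
    arr_sing \<A> = nodes \<A> \<union> tacnodes \<A> \<union> ordinary_triple_points \<A> \<and>
    card (nodes \<A>) = 3 \<and> card (tacnodes \<A>) = 9 \<and> card (ordinary_triple_points \<A>) = 1"
proof -

  \<comment> \<open>The four conics and their special points\<close>
  define C1 where "C1 = tangent_conic 1 1"
  define C2 where "C2 = tangent_conic 1 2"
  define C3 where "C3 = tangent_conic 2 3"
  define Q where "Q = base_conic"
  note C_defs = C1_def C2_def C3_def Q_def
  define \<A> where "\<A> = {C1, C2, C3, Q}"
  define t :: "complex^3" where "t = vector [0, 0, 1]"
  define n12 where "n12 = node_point 1 1 1 2"
  define n13 where "n13 = node_point 1 1 2 3"
  define n23 where "n23 = node_point 1 2 2 3"
  define c12 where "c12 = contact_point 1 1 1 2"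
  define c13 where "c13 = contact_point 1 1 2 3"
  define c23 where "c23 = contact_point 1 2 2 3"
  have ne: "(1::complex) \<noteq> 0" "(2::complex) \<noteq> 0" "(3::complex) \<noteq> 0"
    "(4::complex) * 1\<^sup>2 * 1\<^sup>2 \<noteq> 1" "(4::complex) * 1\<^sup>2 * 2\<^sup>2 \<noteq> 1" "(4::complex) * 2\<^sup>2 * 3\<^sup>2 \<noteq> 1"
    by simp_all
  obtain s1 s1' where s1: "s1 \<noteq> 0" "s1' \<noteq> 0" "vec.span {s1} \<noteq> vec.span {s1'}"
    "\<forall>q\<in>{s1, s1'}. qform C1 q = 0 \<and> qform Q q = 0
       \<and> intersection_mult C1 Q (vec.span {q}) 2 \<and> \<not> transversal_at C1 Q (vec.span {q})"
    "\<forall>q. q \<noteq> 0 \<and> qform C1 q = 0 \<and> qform Q q = 0 \<longrightarrow> vec.span {q} \<in> {vec.span {s1}, vec.span {s1'}}"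
    using base_tangent_contact[OF ne(1,1,4), folded C_defs] by blast
  obtain s2 s2' where s2: "s2 \<noteq> 0" "s2' \<noteq> 0" "vec.span {s2} \<noteq> vec.span {s2'}"
    "\<forall>q\<in>{s2, s2'}. qform C2 q = 0 \<and> qform Q q = 0
       \<and> intersection_mult C2 Q (vec.span {q}) 2 \<and> \<not> transversal_at C2 Q (vec.span {q})"
    "\<forall>q. q \<noteq> 0 \<and> qform C2 q = 0 \<and> qform Q q = 0 \<longrightarrow> vec.span {q} \<in> {vec.span {s2}, vec.span {s2'}}"
    using base_tangent_contact[OF ne(1,2,5), folded C_defs] by blast
  obtain s3 s3' where s3: "s3 \<noteq> 0" "s3' \<noteq> 0" "vec.span {s3} \<noteq> vec.span {s3'}"
    "\<forall>q\<in>{s3, s3'}. qform C3 q = 0 \<and> qform Q q = 0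
       \<and> intersection_mult C3 Q (vec.span {q}) 2 \<and> \<not> transversal_at C3 Q (vec.span {q})"
    "\<forall>q. q \<noteq> 0 \<and> qform C3 q = 0 \<and> qform Q q = 0 \<longrightarrow> vec.span {q} \<in> {vec.span {s3}, vec.span {s3'}}"
    using base_tangent_contact[OF ne(2,3,6), folded C_defs] by blast

  have num: "(1::complex)\<^sup>2 \<noteq> 2\<^sup>2" "(1::complex)\<^sup>2 \<noteq> 3\<^sup>2" "(2::complex)\<^sup>2 \<noteq> 3\<^sup>2"
    "((1::complex)\<^sup>2 * 2\<^sup>2 - 1\<^sup>2 * 1\<^sup>2)\<^sup>2 + (1\<^sup>2 - 2\<^sup>2) * (1\<^sup>2 - 1\<^sup>2) \<noteq> 0"
    "((1::complex)\<^sup>2 * 3\<^sup>2 - 1\<^sup>2 * 2\<^sup>2)\<^sup>2 + (1\<^sup>2 - 3\<^sup>2) * (1\<^sup>2 - 2\<^sup>2) \<noteq> 0"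
    "((1::complex)\<^sup>2 * 3\<^sup>2 - 2\<^sup>2 * 2\<^sup>2)\<^sup>2 + (2\<^sup>2 - 3\<^sup>2) * (1\<^sup>2 - 2\<^sup>2) \<noteq> 0"
    by simp_all
  \<comment> \<open>The quantities \<open>d^2 + A B\<close> for the three pairs are 9, 49 and
    64.\<close>
  have no3: "qform C1 q = 0 \<Longrightarrow> qform C2 q = 0 \<Longrightarrow> qform Q q = 0 \<Longrightarrow> q = 0"
    "qform C1 q = 0 \<Longrightarrow> qform C3 q = 0 \<Longrightarrow> qform Q q = 0 \<Longrightarrow> q = 0"
    "qform C2 q = 0 \<Longrightarrow> qform C3 q = 0 \<Longrightarrow> qform Q q = 0 \<Longrightarrow> q = 0" for q
    by (fact base_tangent_tangent_disjoint[OF num(1,4), folded C_defs]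
      base_tangent_tangent_disjoint[OF num(2,5), folded C_defs]
      base_tangent_tangent_disjoint[OF num(3,6), folded C_defs])+
  have s_off: "qform C2 q \<noteq> 0 \<and> qform C3 q \<noteq> 0" if "q \<in> {s1, s1'}" for q
  proof -
    have "q \<noteq> 0" "qform C1 q = 0" "qform Q q = 0"
      using that s1(1,2,4) by auto
    then show ?thesis using no3[of q] by blast
  qed
  have s_off': "qform C1 q \<noteq> 0 \<and> qform C3 q \<noteq> 0" if "q \<in> {s2, s2'}" for q
  proof -
    have "q \<noteq> 0" "qform C2 q = 0" "qform Q q = 0"
      using that s2(1,2,4) by auto
    then show ?thesis using no3[of q] by blast
  qed
  have s_off'': "qform C1 q \<noteq> 0 \<and> qform C2 q \<noteq> 0" if "q \<in> {s3, s3'}" for q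
  proof -
    have "q \<noteq> 0" "qform C3 q = 0" "qform Q q = 0"
      using that s3(1,2,4) by auto
    then show ?thesis using no3[of q] by blast
  qed

  have vals_s:
    "qform C1 s1 = 0" "qform C2 s1 \<noteq> 0" "qform C3 s1 \<noteq> 0" "qform Q s1 = 0"
    "qform C1 s1' = 0" "qform C2 s1' \<noteq> 0" "qform C3 s1' \<noteq> 0" "qform Q s1' = 0"
    "qform C1 s2 \<noteq> 0" "qform C2 s2 = 0" "qform C3 s2 \<noteq> 0" "qform Q s2 = 0"
    "qform C1 s2' \<noteq> 0" "qform C2 s2' = 0" "qform C3 s2' \<noteq> 0" "qform Q s2' = 0"
    "qform C1 s3 \<noteq> 0" "qform C2 s3 \<noteq> 0" "qform C3 s3 = 0" "qform Q s3 = 0"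
    "qform C1 s3' \<noteq> 0" "qform C2 s3' \<noteq> 0" "qform C3 s3' = 0" "qform Q s3' = 0"
    using s1(4) s2(4) s3(4) s_off s_off' s_off'' by simp_all

  \<comment> \<open>Incidences of the explicit points\<close>
  note coords = t_def n12_def n13_def n23_def c12_def c13_def c23_def
    node_point_def contact_point_def cross_def Let_def
  have ne0: "t \<noteq> 0" "n12 \<noteq> 0" "n13 \<noteq> 0" "n23 \<noteq> 0" "c12 \<noteq> 0" "c13 \<noteq> 0" "c23 \<noteq> 0"
    by (simp_all add: coords vec3_eq_iff)
  have vals:
    "qform C1 t = 0" "qform C2 t = 0" "qform C3 t = 0" "qform Q t \<noteq> 0"
    "qform C1 n12 = 0" "qform C2 n12 = 0" "qform C3 n12 \<noteq> 0" "qform Q n12 \<noteq> 0"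
    "qform C1 n13 = 0" "qform C2 n13 \<noteq> 0" "qform C3 n13 = 0" "qform Q n13 \<noteq> 0"
    "qform C1 n23 \<noteq> 0" "qform C2 n23 = 0" "qform C3 n23 = 0" "qform Q n23 \<noteq> 0"
    "qform C1 c12 = 0" "qform C2 c12 = 0" "qform C3 c12 \<noteq> 0" "qform Q c12 \<noteq> 0"
    "qform C1 c13 = 0" "qform C2 c13 \<noteq> 0" "qform C3 c13 = 0" "qform Q c13 \<noteq> 0"
    "qform C1 c23 \<noteq> 0" "qform C2 c23 = 0" "qform C3 c23 = 0" "qform Q c23 \<noteq> 0"
    unfolding C_defs qform_tangent qform_base by (simp_all add: coords)

  have C_ne: "C1 \<noteq> C2" "C1 \<noteq> C3" "C2 \<noteq> C3" "C1 \<noteq> Q" "C2 \<noteq> Q" "C3 \<noteq> Q"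
    using vals by metis+
  have smooth: "smooth_conic A" if "A \<in> \<A>" for A
    using that smooth_base smooth_tangent unfolding \<A>_def C_defs by auto
  have fin: "finite \<A>"
    by (simp add: \<A>_def)
  have "conic_arrangement \<A>"
    unfolding conic_arrangement_def
  proof (intro conjI ballI smooth)
    show "finite \<A>" by (rule fin)
    have "curve (qform A) \<noteq> curve (qform B)" if "qform A p = 0" "qform B p \<noteq> 0" "p \<noteq> 0" for A B p
      using that span_in_curve_iff by metis
    then have "curve (qform C1) \<noteq> curve (qform C2)" "curve (qform C1) \<noteq> curve (qform C3)"
      "curve (qform C2) \<noteq> curve (qform C3)" "curve (qform C1) \<noteq> curve (qform Q)"
      "curve (qform C2) \<noteq> curve (qform Q)" "curve (qform C3) \<noteq> curve (qform Q)"
      using vals ne0 by blast+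
    then show "inj_on (\<lambda>A. curve (qform A)) \<A>"
      unfolding \<A>_def inj_on_def by auto
  qed

  \<comment> \<open>Branches through the special points\<close>
  have br: "branches \<A> (vec.span {p}) = {A \<in> \<A>. qform A p = 0}" if "p \<noteq> 0" for p
    using that by (simp add: branches_def span_in_curve_iff)
  have arr_eq: "arr_sing \<A> = {P \<in> proj_plane. \<exists>A\<in>branches \<A> P. \<exists>B\<in>branches \<A> P. A \<noteq> B}"
    by (rule arr_sing_eq[OF fin smooth])
  have sing: "vec.span {p} \<in> arr_sing \<A> \<longleftrightarrow> (\<exists>A\<in>\<A>. \<exists>B\<in>\<A>. A \<noteq> B \<and> qform A p = 0 \<and> qform B p = 0)"
    if "p \<noteq> 0" for p
    unfolding arr_eq using that by (simp add: span_in_proj_plane br) blast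

  define S :: "complex^3 \<Rightarrow> (complex^3) set" where "S p = vec.span {p}" for p
  have br_S: "A \<in> branches \<A> (S p) \<longleftrightarrow> A \<in> {C1, C2, C3, Q} \<and> qform A p = 0" if "p \<noteq> 0" for A p
    unfolding S_def br[OF that] unfolding \<A>_def by blast
  have br_t: "branches \<A> (S t) = {C1, C2, C3}"
    and br_n: "branches \<A> (S n12) = {C1, C2}" "branches \<A> (S n13) = {C1, C3}" "branches \<A> (S n23) = {C2, C3}"
    and br_c: "branches \<A> (S c12) = {C1, C2}" "branches \<A> (S c13) = {C1, C3}" "branches \<A> (S c23) = {C2, C3}"
    by (auto simp: br_S ne0 vals)
  have br_s: "branches \<A> (S s1) = {C1, Q}" "branches \<A> (S s1') = {C1, Q}"
    "branches \<A> (S s2) = {C2, Q}" "branches \<A> (S s2') = {C2, Q}"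
    "branches \<A> (S s3) = {C3, Q}" "branches \<A> (S s3') = {C3, Q}"
    by (auto simp: br_S s1(1,2) s2(1,2) s3(1,2) vals_s)
  have arrI: "S p \<in> arr_sing \<A>" if "p \<noteq> 0" "{A, B} \<subseteq> branches \<A> (S p)" "A \<noteq> B" for p A B
    using that unfolding arr_eq S_def by (auto simp: span_in_proj_plane)
  have sing_t: "S t \<in> arr_sing \<A>"
    using arrI[OF ne0(1) _ C_ne(1)] by (simp add: br_t)
  have sing_n: "S n12 \<in> arr_sing \<A>" "S n13 \<in> arr_sing \<A>" "S n23 \<in> arr_sing \<A>"
    using arrI[OF ne0(2) _ C_ne(1)] arrI[OF ne0(3) _ C_ne(2)] arrI[OF ne0(4) _ C_ne(3)]
    by (simp_all add: br_n)
  have sing_c: "S c12 \<in> arr_sing \<A>" "S c13 \<in> arr_sing \<A>" "S c23 \<in> arr_sing \<A>"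
    using arrI[OF ne0(5) _ C_ne(1)] arrI[OF ne0(6) _ C_ne(2)] arrI[OF ne0(7) _ C_ne(3)]
    by (simp_all add: br_c)
  have sing_s: "S s1 \<in> arr_sing \<A>" "S s1' \<in> arr_sing \<A>" "S s2 \<in> arr_sing \<A>"
    "S s2' \<in> arr_sing \<A>" "S s3 \<in> arr_sing \<A>" "S s3' \<in> arr_sing \<A>"
    using arrI[OF s1(1) _ C_ne(4)] arrI[OF s1(2) _ C_ne(4)] arrI[OF s2(1) _ C_ne(5)]
      arrI[OF s2(2) _ C_ne(5)] arrI[OF s3(1) _ C_ne(6)] arrI[OF s3(2) _ C_ne(6)]
    by (simp_all add: br_s)

  \<comment> \<open>Completeness of the list of singular points\<close>
  have inter:
    "\<And>q. q \<noteq> 0 \<Longrightarrow> qform C1 q = 0 \<Longrightarrow> qform C2 q = 0 \<Longrightarrow> S q \<in> {S t, S n12, S c12}"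
    "\<And>q. q \<noteq> 0 \<Longrightarrow> qform C1 q = 0 \<Longrightarrow> qform C3 q = 0 \<Longrightarrow> S q \<in> {S t, S n13, S c13}"
    "\<And>q. q \<noteq> 0 \<Longrightarrow> qform C2 q = 0 \<Longrightarrow> qform C3 q = 0 \<Longrightarrow> S q \<in> {S t, S n23, S c23}"
    unfolding S_def C_defs t_def n12_def n13_def n23_def c12_def c13_def c23_def
    by (rule tangent_tangent_intersection; (assumption | simp))+
  have inter_s:
    "\<And>q. q \<noteq> 0 \<Longrightarrow> qform C1 q = 0 \<Longrightarrow> qform Q q = 0 \<Longrightarrow> S q \<in> {S s1, S s1'}"
    "\<And>q. q \<noteq> 0 \<Longrightarrow> qform C2 q = 0 \<Longrightarrow> qform Q q = 0 \<Longrightarrow> S q \<in> {S s2, S s2'}"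
    "\<And>q. q \<noteq> 0 \<Longrightarrow> qform C3 q = 0 \<Longrightarrow> qform Q q = 0 \<Longrightarrow> S q \<in> {S s3, S s3'}"
    using s1(5) s2(5) s3(5) unfolding S_def by simp_all
  have arr: "arr_sing \<A> = {S n12, S n13, S n23} \<union>
      {S c12, S c13, S c23, S s1, S s1', S s2, S s2', S s3, S s3'} \<union> {S t}"
    (is "_ = ?N \<union> ?C \<union> ?T")
  proof (intro set_eqI iffI)
    fix P
    assume P: "P \<in> arr_sing \<A>"
    then have "P \<in> proj_plane"
      by (simp add: arr_sing_def sing_points_def curve_def)
    then obtain p where p: "p \<noteq> 0" "P = S p"
      unfolding S_def by (rule proj_planeE)
    with P have "\<exists>A\<in>\<A>. \<exists>B\<in>\<A>. A \<noteq> B \<and> qform A p = 0 \<and> qform B p = 0"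
      by (simp add: S_def sing)
    then have cases: "qform C1 p = 0 \<and> qform C2 p = 0 \<or> qform C1 p = 0 \<and> qform C3 p = 0
      \<or> qform C2 p = 0 \<and> qform C3 p = 0 \<or> qform C1 p = 0 \<and> qform Q p = 0
      \<or> qform C2 p = 0 \<and> qform Q p = 0 \<or> qform C3 p = 0 \<and> qform Q p = 0"
      unfolding \<A>_def by auto
    have cover: "{S t, S n12, S c12} \<subseteq> ?N \<union> ?C \<union> ?T" "{S t, S n13, S c13} \<subseteq> ?N \<union> ?C \<union> ?T"
      "{S t, S n23, S c23} \<subseteq> ?N \<union> ?C \<union> ?T" "{S s1, S s1'} \<subseteq> ?N \<union> ?C \<union> ?T"
      "{S s2, S s2'} \<subseteq> ?N \<union> ?C \<union> ?T" "{S s3, S s3'} \<subseteq> ?N \<union> ?C \<union> ?T"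
      by simp_all
    show "P \<in> ?N \<union> ?C \<union> ?T"
      unfolding p(2) using cases
      by (elim disjE conjE) (rule subsetD[OF cover(1) inter(1)[OF p(1)]]
        subsetD[OF cover(2) inter(2)[OF p(1)]] subsetD[OF cover(3) inter(3)[OF p(1)]]
        subsetD[OF cover(4) inter_s(1)[OF p(1)]] subsetD[OF cover(5) inter_s(2)[OF p(1)]]
        subsetD[OF cover(6) inter_s(3)[OF p(1)]]; assumption)+
  next
    fix P
    assume "P \<in> ?N \<union> ?C \<union> ?T"
    then show "P \<in> arr_sing \<A>"
      using sing_t sing_n sing_c sing_s by auto
  qed

  \<comment> \<open>Local types of the singular points\<close>
  have n_loc:
    "transversal_at C1 C2 (S n12)" "\<not> intersection_mult C1 C2 (S n12) 2"
    "transversal_at C1 C3 (S n13)" "\<not> intersection_mult C1 C3 (S n13) 2"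
    "transversal_at C2 C3 (S n23)" "\<not> intersection_mult C2 C3 (S n23) 2"
    unfolding S_def C_defs n12_def n13_def n23_def by (rule node_point_transversal; simp)+
  have N: "?N \<subseteq> nodes \<A> - tacnodes \<A> - ordinary_triple_points \<A>"
    unfolding insert_subset
    by (intro conjI empty_subsetI nodeI[OF sing_n(1) br_n(1) C_ne(1) n_loc(1,2)]
      nodeI[OF sing_n(2) br_n(2) C_ne(2) n_loc(3,4)] nodeI[OF sing_n(3) br_n(3) C_ne(3) n_loc(5,6)])
  have c_loc:
    "intersection_mult C1 C2 (S c12) 2" "\<not> transversal_at C1 C2 (S c12)"
    "intersection_mult C1 C3 (S c13) 2" "\<not> transversal_at C1 C3 (S c13)"
    "intersection_mult C2 C3 (S c23) 2" "\<not> transversal_at C2 C3 (S c23)"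
    unfolding S_def C_defs c12_def c13_def c23_def by (rule contact_point_tangent; simp)+
  have s_loc:
    "intersection_mult C1 Q (S s1) 2" "\<not> transversal_at C1 Q (S s1)"
    "intersection_mult C1 Q (S s1') 2" "\<not> transversal_at C1 Q (S s1')"
    "intersection_mult C2 Q (S s2) 2" "\<not> transversal_at C2 Q (S s2)"
    "intersection_mult C2 Q (S s2') 2" "\<not> transversal_at C2 Q (S s2')"
    "intersection_mult C3 Q (S s3) 2" "\<not> transversal_at C3 Q (S s3)"
    "intersection_mult C3 Q (S s3') 2" "\<not> transversal_at C3 Q (S s3')"
    using s1(4) s2(4) s3(4) unfolding S_def by simp_all
  have C: "?C \<subseteq> tacnodes \<A> - nodes \<A> - ordinary_triple_points \<A>"
    unfolding insert_subset
    by (intro conjI empty_subsetI tacnodeI[OF sing_c(1) br_c(1) C_ne(1) c_loc(2,1)]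
      tacnodeI[OF sing_c(2) br_c(2) C_ne(2) c_loc(4,3)] tacnodeI[OF sing_c(3) br_c(3) C_ne(3) c_loc(6,5)]
      tacnodeI[OF sing_s(1) br_s(1) C_ne(4) s_loc(2,1)] tacnodeI[OF sing_s(2) br_s(2) C_ne(4) s_loc(4,3)]
      tacnodeI[OF sing_s(3) br_s(3) C_ne(5) s_loc(6,5)] tacnodeI[OF sing_s(4) br_s(4) C_ne(5) s_loc(8,7)]
      tacnodeI[OF sing_s(5) br_s(5) C_ne(6) s_loc(10,9)] tacnodeI[OF sing_s(6) br_s(6) C_ne(6) s_loc(12,11)])
  have t_loc: "transversal_at C1 C2 (S t)" "transversal_at C1 C3 (S t)" "transversal_at C2 C3 (S t)"
    unfolding S_def C_defs t_def by (rule vertex_transversal; simp)+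
  have T: "?T \<subseteq> ordinary_triple_points \<A> - nodes \<A> - tacnodes \<A>"
    using ordinary_triple_pointI[OF sing_t br_t C_ne(1,2,3) t_loc] by simp

  have sub: "nodes \<A> \<subseteq> arr_sing \<A>" "tacnodes \<A> \<subseteq> arr_sing \<A>" "ordinary_triple_points \<A> \<subseteq> arr_sing \<A>"
    by (auto simp: nodes_def tacnodes_def ordinary_triple_points_def)
  have eqs: "nodes \<A> = ?N" "tacnodes \<A> = ?C" "ordinary_triple_points \<A> = ?T"
    using disjoint_cover_eq[OF sub[unfolded arr] N C T] .

  \<comment> \<open>Within one class, branch sets separate all points except the two contact points
    of a conic with \<open>Q\<close>, which \<open>S_ne\<close> separates.\<close>
  have neq: "P \<noteq> P'" if "branches \<A> P \<noteq> branches \<A> P'" for P P'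
    using that by blast
  have S_ne: "S s1 \<noteq> S s1'" "S s2 \<noteq> S s2'" "S s3 \<noteq> S s3'"
    using s1(3) s2(3) s3(3) by (simp_all add: S_def)
  have "distinct [S n12, S n13, S n23]"
    by (simp, intro conjI; rule neq; simp add: br_n doubleton_eq_iff C_ne C_ne[symmetric])
  from distinct_card[OF this] have "card ?N = 3"
    by simp
  moreover have "distinct [S c12, S c13, S c23, S s1, S s1', S s2, S s2', S s3, S s3']"
    by (simp add: S_ne, intro conjI; rule neq; simp add: br_c br_s doubleton_eq_iff C_ne C_ne[symmetric])
  from distinct_card[OF this] have "card ?C = 9"
    by simp
  moreover have "card \<A> = 4"
    using C_ne by (simp add: \<A>_def)
  ultimately show ?thesis
    using \<open>conic_arrangement \<A>\<close> arr eqs by (intro exI[of _ \<A>]) simp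
qed

end
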